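(* Let $G$ be a graph on $[0,n]$. Then the left-degree polynomial $L_G(\mathbf{t})$ has saturated Newton polytope (SNP), and the Newton polytope of each (nonzero) homogeneous component $L_G^k(\mathbf{t})$ of $L_G(\mathbf{t})$ of degree $\#E(G)-k$ is a generalized permutahedron.
   Context: Notation: $[m,n]=\{m,\dots,n\}$, $[n]=[1,n]$. A graph on $[0,n]$ is a finite directed graph in which every edge is directed from its smaller endpoint to its larger endpoint; multiple edges are allowed and their copies are regarded as distinct. $(i,j)$ with $i<j$ denotes an edge from $i$ to $j$; $\mathrm{indeg}_G(i)$ is the number of edges of $G$ whose larger endpoint is $i$. Reduction: if $G_0$ has edges $(i,j)$ and $(j,k)$ with $i<j<k$, the reduction of $G_0$ on these edges (at vertex $j$) produces three graphs on the same vertices with edge multisets $E(G_0)\setminus\{(j,k)\}\cup\{(i,k)\}$, $E(G_0)\setminus\{(i,j)\}\cup\{(i,k)\}$, and $E(G_0)\setminus\{(i,j),(j,k)\}\cup\{(i,k)\}$. A reduction tree of $G$ is a rooted tree with root labeled $G$ in which each non-leaf node has three children labeled by the three graphs obtained from one reduction on its graph, and whose leaf graphs admit no reduction. $\mathrm{InSeq}(\mathcal{R})$ is the multiset of left-degree sequences $(\mathrm{indeg}_L(1),\dots,\mathrm{indeg}_L(n))$ over all leaves $L$ of $\mathcal{R}$. The specific reduction tree $\mathcal{T}(G)$: $G[0,i]$ is the restriction of $G$ to $[0,i]$, $I_i$ is the multiset of edges of $G$ incoming to $i$, $V_i=\{k : (k,i)\in I_i\}$. $\mathcal{T}(G[0,1])$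 is the single leaf $G[0,1]$; $\mathcal{T}(G[0,i+1])$ is obtained from $\mathcal{T}(G[0,i])$ by appending vertex $i+1$ and the edges $I_{i+1}$ to all graphs, and then, from each leaf of $\mathcal{T}(G[0,i])$, performing all possible reductions at each vertex of $V_{i+1}$, always reducing on the longest edges possible incident to the vertex at which one is reducing (length of $(i,j)$ is $j-i$). $\mathcal{T}(G)=\mathcal{T}(G[0,n])$ and $\mathrm{LD}(G)=\mathrm{InSeq}(\mathcal{T}(G))$. Left-degree polynomial: for $\alpha\in\mathrm{LD}(G)$ let $\mathrm{codim}(\alpha)=\#E(G)-\sum_{i=1}^n\alpha_i$; then, in variables $\mathbf{t}=(t_1,\dots,t_n)$, $L_G(\mathbf{t})=\sum_{\alpha\in\mathrm{LD}(G)}(-1)^{\mathrm{codim}(\alpha)}\mathbf{t}^\alpha$ (sum with multiplicity). For a polynomial $f=\sum_\alpha c_\alpha\mathbf{t}^\alpha$, $\mathrm{Newton}(f)=\mathrm{Conv}\{\alpha : c_\alpha\ne0\}$; $f$ has SNP if the integer points of $\mathrm{Newton}(f)$ are exactly the exponents $\alpha$ with $c_\alpha\neq0$. A generalized permutahedron in $\mathbb{R}^n$ is a polytope of the form $P_n^z(\{z_I\})=\{\mathbf{t}\in\mathbb{R}^n : \sum_{i\in I}t_i\ge z_I \text{ for } I\subsetneq[n],\ \sum_{i=1}^n t_i=z_{[n]}\}$, where $\{z_I\}_{I\subseteq[n]}$ are real numbers with $z_\emptyset=0$ and $z_{I\cup J}+z_{I\cap J}\ge z_I+z_J$ for all $I,J\subseteq[n]$.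 *)

theory Defs
  imports "HOL-Analysis.Analysis" "HOL-Analysis.Finite_Function_Topology" "HOL-Library.Multiset"
begin

section \<open>Graphs and reduction trees\<close>

text \<open>
  A graph is its multiset of edges; \<open>(i, j)\<close> is an edge from \<open>i\<close> to \<open>j\<close>. Parallel edges are
  recorded by multiplicity: reducing on different copies of the same edges produces the same edge
  multisets.
\<close>

type_synonym graph = "(nat \<times> nat) multiset"

definition graph_on :: "nat \<Rightarrow> graph \<Rightarrow> bool" where
  "graph_on n G \<longleftrightarrow> (\<forall>(i, j) \<in># G. i < j \<and> j \<le> n)"

definition indeg :: "graph \<Rightarrow> nat \<Rightarrow> nat" where
  "indeg G i = size {#e \<in># G. snd e = i#}"

definition reduct1 :: "graph \<Rightarrow> nat \<Rightarrow> nat \<Rightarrow> nat \<Rightarrow> graph" where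
  "reduct1 G i j k = G - {#(j, k)#} + {#(i, k)#}"

definition reduct2 :: "graph \<Rightarrow> nat \<Rightarrow> nat \<Rightarrow> nat \<Rightarrow> graph" where
  "reduct2 G i j k = G - {#(i, j)#} + {#(i, k)#}"

definition reduct3 :: "graph \<Rightarrow> nat \<Rightarrow> nat \<Rightarrow> nat \<Rightarrow> graph" where
  "reduct3 G i j k = G - {#(i, j), (j, k)#} + {#(i, k)#}"

definition reducible_at :: "graph \<Rightarrow> nat \<Rightarrow> bool" where
  "reducible_at G j \<longleftrightarrow> (\<exists>i k. i < j \<and> j < k \<and> (i, j) \<in># G \<and> (j, k) \<in># G)"

datatype gtree = Leaf graph | Node graph gtree gtree gtree

primrec leaves :: "gtree \<Rightarrow> graph multiset" where
  "leaves (Leaf G) = {#G#}"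
| "leaves (Node G T1 T2 T3) = leaves T1 + leaves T2 + leaves T3"

inductive reduction_tree :: "graph \<Rightarrow> gtree \<Rightarrow> bool" where
  leaf: "(\<And>j. \<not> reducible_at G j) \<Longrightarrow> reduction_tree G (Leaf G)"
| node: "\<lbrakk>i < j; j < k; (i, j) \<in># G; (j, k) \<in># G;
          reduction_tree (reduct1 G i j k) T1;
          reduction_tree (reduct2 G i j k) T2;
          reduction_tree (reduct3 G i j k) T3\<rbrakk>
         \<Longrightarrow> reduction_tree G (Node G T1 T2 T3)"

text \<open>
  The left-degree sequence \<open>(indeg L 1, \<dots>, indeg L n)\<close> is represented as an exponent vector, i.e. a
  finitely supported function vanishing outside \<open>{1..n}\<close>.
\<close>

definition left_degree_seq :: "nat \<Rightarrow> graph \<Rightarrow> (nat \<Rightarrow>\<^sub>0 nat)" where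
  "left_degree_seq n L = (\<Sum>i = 1..n. Poly_Mapping.single i (indeg L i))"

definition InSeq :: "nat \<Rightarrow> gtree \<Rightarrow> (nat \<Rightarrow>\<^sub>0 nat) multiset" where
  "InSeq n T = image_mset (left_degree_seq n) (leaves T)"


section \<open>The specific reduction tree\<close>

definition edge_length :: "nat \<times> nat \<Rightarrow> nat" where
  "edge_length e = snd e - fst e"

definition longest_in :: "graph \<Rightarrow> nat \<times> nat \<Rightarrow> bool" where
  "longest_in G e \<longleftrightarrow> e \<in># G \<and> (\<forall>e' \<in># G. snd e' = snd e \<longrightarrow> edge_length e' \<le> edge_length e)"

definition longest_out :: "graph \<Rightarrow> nat \<times> nat \<Rightarrow> bool" where
  "longest_out G e \<longleftrightarrow> e \<in># G \<and> (\<forall>e' \<in># G. fst e' = fst e \<longrightarrow> edge_length e' \<le> edge_length e)"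

definition restrict_graph :: "graph \<Rightarrow> nat \<Rightarrow> graph" where
  "restrict_graph G i = {#e \<in># G. fst e \<le> i \<and> snd e \<le> i#}"

definition incoming :: "graph \<Rightarrow> nat \<Rightarrow> graph" where
  "incoming G i = {#e \<in># G. snd e = i#}"

definition in_nbrs :: "graph \<Rightarrow> nat \<Rightarrow> nat set" where
  "in_nbrs G i = {k. (k, i) \<in># incoming G i}"

text \<open>
  \<open>longest_reductions V H T\<close>: the tree \<open>T\<close> arises from \<open>H\<close> by performing all possible reductions at
  the vertices of \<open>V\<close>, always on the longest edges. The construction does not say in which order the
  vertices of \<open>V\<close> are treated, and every order is allowed here.
\<close>

inductive longest_reductions :: "nat set \<Rightarrow> graph \<Rightarrow> gtree \<Rightarrow> bool" for V where
  stop: "(\<And>j. j \<in> V \<Longrightarrow> \<not> reducible_at H j) \<Longrightarrow> longest_reductions V H (Leaf H)"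
| reduce: "\<lbrakk>j \<in> V; i < j; j < k; longest_in H (i, j); longest_out H (j, k);
            longest_reductions V (reduct1 H i j k) T1;
            longest_reductions V (reduct2 H i j k) T2;
            longest_reductions V (reduct3 H i j k) T3\<rbrakk>
           \<Longrightarrow> longest_reductions V H (Node H T1 T2 T3)"

text \<open>
  \<open>extend_tree V I T T'\<close>: the edges \<open>I\<close> are appended to all graphs of \<open>T\<close>, and every leaf of \<open>T\<close> is
  then expanded by longest reductions at \<open>V\<close>.
\<close>

inductive extend_tree :: "nat set \<Rightarrow> graph \<Rightarrow> gtree \<Rightarrow> gtree \<Rightarrow> bool" for V I where
  leaf: "longest_reductions V (H + I) T \<Longrightarrow> extend_tree V I (Leaf H) T"
| node: "\<lbrakk>extend_tree V I T1 T1'; extend_tree V I T2 T2'; extend_tree V I T3 T3'\<rbrakk>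
         \<Longrightarrow> extend_tree V I (Node H T1 T2 T3) (Node (H + I) T1' T2' T3')"

text \<open>
  \<open>specific_tree G i T\<close>: \<open>T\<close> is a tree \<open>\<T>(G[0,i])\<close>. The case \<open>i = 0\<close> only serves the edgeless
  graph on the single vertex \<open>0\<close>.
\<close>

inductive specific_tree :: "graph \<Rightarrow> nat \<Rightarrow> gtree \<Rightarrow> bool" for G where
  base: "i \<le> 1 \<Longrightarrow> specific_tree G i (Leaf (restrict_graph G i))"
| step: "\<lbrakk>1 \<le> i; specific_tree G i T;
          extend_tree (in_nbrs G (Suc i)) (incoming G (Suc i)) T T'\<rbrakk>
         \<Longrightarrow> specific_tree G (Suc i) T'"


section \<open>Polynomials and Newton polytopes\<close>

text \<open>
  Polynomials in \<open>t\<^sub>1, t\<^sub>2, \<dots>\<close> are finitely supported maps from exponent vectors to coefficients, and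
  points of \<open>\<real>\<^sup>n\<close> are finitely supported real functions on \<open>nat\<close> vanishing outside \<open>{1..n}\<close>.
\<close>

type_synonym exponent = "nat \<Rightarrow>\<^sub>0 nat"

definition total_degree :: "exponent \<Rightarrow> nat" where
  "total_degree \<alpha> = (\<Sum>i\<in>Poly_Mapping.keys \<alpha>. Poly_Mapping.lookup \<alpha> i)"

definition exponent_point :: "exponent \<Rightarrow> (nat \<Rightarrow>\<^sub>0 real)" where
  "exponent_point \<alpha> = Poly_Mapping.map real \<alpha>"

definition Newton :: "(exponent \<Rightarrow>\<^sub>0 int) \<Rightarrow> (nat \<Rightarrow>\<^sub>0 real) set" where
  "Newton f = convex hull (exponent_point ` Poly_Mapping.keys f)"

definition SNP :: "(exponent \<Rightarrow>\<^sub>0 int) \<Rightarrow> bool" where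
  "SNP f \<longleftrightarrow>
     {x \<in> Newton f. \<forall>i. Poly_Mapping.lookup x i \<in> \<int>} = exponent_point ` Poly_Mapping.keys f"

definition homogeneous_component :: "nat \<Rightarrow> (exponent \<Rightarrow>\<^sub>0 int) \<Rightarrow> (exponent \<Rightarrow>\<^sub>0 int)" where
  "homogeneous_component d f =
     (\<Sum>\<alpha> | \<alpha> \<in> Poly_Mapping.keys f \<and> total_degree \<alpha> = d.
        Poly_Mapping.single \<alpha> (Poly_Mapping.lookup f \<alpha>))"

definition perm_polytope :: "nat \<Rightarrow> (nat set \<Rightarrow> real) \<Rightarrow> (nat \<Rightarrow>\<^sub>0 real) set" where
  "perm_polytope n z =
     {t. Poly_Mapping.keys t \<subseteq> {1..n} \<and>
         (\<forall>I. I \<subset> {1..n} \<longrightarrow> (\<Sum>i\<in>I. Poly_Mapping.lookup t i) \<ge> z I) \<and>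
         (\<Sum>i = 1..n. Poly_Mapping.lookup t i) = z {1..n}}"

definition generalized_permutahedron :: "nat \<Rightarrow> (nat \<Rightarrow>\<^sub>0 real) set \<Rightarrow> bool" where
  "generalized_permutahedron n P \<longleftrightarrow>
     (\<exists>z. z {} = 0 \<and>
          (\<forall>I J. I \<subseteq> {1..n} \<longrightarrow> J \<subseteq> {1..n} \<longrightarrow> z (I \<union> J) + z (I \<inter> J) \<ge> z I + z J) \<and>
          P = perm_polytope n z)"


section \<open>The left-degree polynomial\<close>

text \<open>
  The argument \<open>T\<close> is a specific reduction tree of \<open>G\<close>. The natural number subtraction in the
  codimension does not truncate: reductions never increase the number of edges.
\<close>

definition left_degree_polynomial :: "nat \<Rightarrow> graph \<Rightarrow> gtree \<Rightarrow> (exponent \<Rightarrow>\<^sub>0 int)" where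
  "left_degree_polynomial n G T =
     (\<Sum>\<alpha>\<in>#InSeq n T.
        Poly_Mapping.single \<alpha> ((-1) ^ (size G - (\<Sum>i = 1..n. Poly_Mapping.lookup \<alpha> i))))"


section \<open>Specific reduction trees exist and are reduction trees\<close>

lemma mset_pair_subset:
  assumes "x \<in># H" "y \<in># H" "x \<noteq> y"
  shows "{#x, y#} \<subseteq># H"
  using assms by (metis add_mset_subseteq_single_iff insert_DiffM insert_noteq_member
      mset_subset_eq_add_mset_cancel mset_subset_eq_single)

lemma reduct_add:
  assumes "(i, j) \<in># H" "(j, k) \<in># H" "i < j"
  shows "reduct1 (H + I) i j k = reduct1 H i j k + I"
    and "reduct2 (H + I) i j k = reduct2 H i j k + I"
    and "reduct3 (H + I) i j k = reduct3 H i j k + I"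
proof -
  have "{#(i, j), (j, k)#} \<subseteq># H"
    using assms by (intro mset_pair_subset) auto
  then show "reduct3 (H + I) i j k = reduct3 H i j k + I"
    by (simp add: reduct3_def subset_mset.add_diff_assoc2)
qed (use assms in \<open>simp_all add: reduct1_def reduct2_def\<close>)

lemma reduct_mem:
  "x \<in># reduct1 H i j k \<Longrightarrow> x \<in># H \<or> x = (i, k)"
  "x \<in># reduct2 H i j k \<Longrightarrow> x \<in># H \<or> x = (i, k)"
  "x \<in># reduct3 H i j k \<Longrightarrow> x \<in># H \<or> x = (i, k)"
  by (auto simp: reduct1_def reduct2_def reduct3_def dest: in_diffD)

definition reduction_weight :: "nat \<Rightarrow> graph \<Rightarrow> nat" where
  "reduction_weight N H = (\<Sum>e\<in>#H. Suc N - edge_length e)"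

lemma graph_on_reduct:
  assumes "graph_on N H" "(i, j) \<in># H" "(j, k) \<in># H"
  shows "graph_on N (reduct1 H i j k)" "graph_on N (reduct2 H i j k)"
    "graph_on N (reduct3 H i j k)"
proof -
  have "i < j" "j < k" "k \<le> N"
    using assms by (auto simp: graph_on_def)
  then show "graph_on N (reduct1 H i j k)" "graph_on N (reduct2 H i j k)"
    "graph_on N (reduct3 H i j k)"
    using assms(1) unfolding graph_on_def by (fastforce dest: reduct_mem)+
qed

lemma reduction_weight_less:
  assumes "graph_on N H" "(i, j) \<in># H" "(j, k) \<in># H"
  shows "reduction_weight N (reduct1 H i j k) < reduction_weight N H"
    and "reduction_weight N (reduct2 H i j k) < reduction_weight N H"
    and "reduction_weight N (reduct3 H i j k) < reduction_weight N H"
proof -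
  have ijk: "i < j" "j < k" "k \<le> N"
    using assms by (auto simp: graph_on_def)
  obtain M where M: "H = {#(i, j), (j, k)#} + M"
    using mset_pair_subset[OF assms(2,3)] ijk by (auto simp: mset_subset_eq_exists_conv)
  have "reduct1 H i j k = {#(i, k), (i, j)#} + M"
    "reduct2 H i j k = {#(i, k), (j, k)#} + M"
    "reduct3 H i j k = {#(i, k)#} + M"
    using ijk by (auto simp: M reduct1_def reduct2_def reduct3_def)
  then show "reduction_weight N (reduct1 H i j k) < reduction_weight N H"
    "reduction_weight N (reduct2 H i j k) < reduction_weight N H"
    "reduction_weight N (reduct3 H i j k) < reduction_weight N H"
    using ijk by (auto simp: M reduction_weight_def edge_length_def)
qed

lemma longest_reductions_exist:
  "graph_on N H \<Longrightarrow> \<exists>T. longest_reductions V H T"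
proof (induction "reduction_weight N H" arbitrary: H rule: less_induct)
  case less
  show ?case
  proof (cases "\<exists>j\<in>V. reducible_at H j")
    case False
    then show ?thesis
      by (blast intro: longest_reductions.stop)
  next
    case True
    then obtain j a b where j: "j \<in> V" "(a, j) \<in># H" "(j, b) \<in># H"
      by (auto simp: reducible_at_def)
    let ?A = "{i. (i, j) \<in># H}" and ?B = "{k. (j, k) \<in># H}"
    have "?A \<subseteq> fst ` set_mset H" "?B \<subseteq> snd ` set_mset H"
      by force+
    then have "finite ?A" "finite ?B"
      by (auto intro: finite_subset)
    moreover have "a \<in> ?A" "b \<in> ?B"
      using j by auto
    ultimately have AB: "Min ?A \<in> ?A" "Max ?B \<in> ?B"
      "\<And>i. i \<in> ?A \<Longrightarrow> Min ?A \<le> i" "\<And>k. k \<in> ?B \<Longrightarrow> k \<le> Max ?B"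
      using Min_in[of ?A] Max_in[of ?B] by auto
    define i k where "i = Min ?A" and "k = Max ?B"
    have ik: "(i, j) \<in># H" "(j, k) \<in># H" "longest_in H (i, j)" "longest_out H (j, k)"
      using AB by (auto simp: i_def k_def longest_in_def longest_out_def edge_length_def
          intro: diff_le_mono2 diff_le_mono)
    have "i < j" "j < k"
      using ik less.prems by (auto simp: graph_on_def)
    note w = reduction_weight_less[OF less.prems ik(1,2)]
      and g = graph_on_reduct[OF less.prems ik(1,2)]
    obtain T1 T2 T3 where "longest_reductions V (reduct1 H i j k) T1"
      "longest_reductions V (reduct2 H i j k) T2" "longest_reductions V (reduct3 H i j k) T3"
      using less.hyps[OF w(1) g(1)] less.hyps[OF w(2) g(2)] less.hyps[OF w(3) g(3)] by blast
    then show ?thesis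
      using longest_reductions.reduce[OF j(1) \<open>i < j\<close> \<open>j < k\<close> ik(3,4)] by blast
  qed
qed

lemma longest_reductions_reduction_tree:
  assumes "longest_reductions V H T"
    and "graph_on N H" "\<And>a v k. (a, v) \<in># H \<Longrightarrow> (v, k) \<in># H \<Longrightarrow> v \<in> V \<and> k = N"
  shows "reduction_tree H T"
  using assms
proof (induction rule: longest_reductions.induct)
  case (stop H)
  have "\<not> reducible_at H j" for j
    using stop.hyps stop.prems(2) unfolding reducible_at_def by blast
  then show ?case
    by (rule reduction_tree.leaf)
next
  case (reduce j i k H T1 T2 T3)
  have e: "(i, j) \<in># H" "(j, k) \<in># H"
    using reduce.hyps by (auto simp: longest_in_def longest_out_def)
  have kN: "k = N"
    using reduce.prems(2)[OF e] by simp
  have no: "(b, i) \<notin># H" for b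
    using reduce.prems(2)[of b i j] e(1) \<open>j < k\<close> kN by blast
  have no': "(k, b) \<notin># H" for b
    using reduce.prems(1) kN by (fastforce simp: graph_on_def)
  have inv: "v \<in> V \<and> c = N"
    if "\<And>x. x \<in># H' \<Longrightarrow> x \<in># H \<or> x = (i, k)" "(a, v) \<in># H'" "(v, c) \<in># H'" for H' a v c
  proof -
    have "(a, v) \<in># H"
      using that(1)[OF that(2)] that(1)[OF that(3)] no' \<open>i < j\<close> \<open>j < k\<close> by auto
    moreover from this have "(v, c) \<in># H"
      using that(1)[OF that(3)] no by auto
    ultimately show ?thesis
      using reduce.prems(2) by blast
  qed
  note g = graph_on_reduct[OF reduce.prems(1) e]
  have "reduction_tree (reduct1 H i j k) T1"
    by (rule reduce.IH(1)[OF g(1)]) (rule inv[OF reduct_mem(1)])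
  moreover have "reduction_tree (reduct2 H i j k) T2"
    by (rule reduce.IH(2)[OF g(2)]) (rule inv[OF reduct_mem(2)])
  moreover have "reduction_tree (reduct3 H i j k) T3"
    by (rule reduce.IH(3)[OF g(3)]) (rule inv[OF reduct_mem(3)])
  ultimately show ?case
    using e reduce.hyps by (blast intro: reduction_tree.node)
qed

lemma graph_on_incoming: "graph_on n G \<Longrightarrow> graph_on m (incoming G m)"
  by (auto simp: graph_on_def incoming_def)

lemma extend_tree_reduction_tree:
  assumes "reduction_tree H T" "graph_on i H" "graph_on n G"
  shows "\<exists>T'. extend_tree (in_nbrs G (Suc i)) (incoming G (Suc i)) T T'"
    and "extend_tree (in_nbrs G (Suc i)) (incoming G (Suc i)) T T' \<Longrightarrow>
      reduction_tree (H + incoming G (Suc i)) T'"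
proof -
  let ?I = "incoming G (Suc i)" and ?V = "in_nbrs G (Suc i)"
  have I: "graph_on (Suc i) ?I"
    by (rule graph_on_incoming[OF assms(3)])
  have "(\<exists>T'. extend_tree ?V ?I T T') \<and>
      (\<forall>T'. extend_tree ?V ?I T T' \<longrightarrow> reduction_tree (H + ?I) T')"
    using assms(1,2)
  proof (induction rule: reduction_tree.induct)
    case (leaf L)
    have L: "graph_on (Suc i) (L + ?I)"
      using leaf.prems I by (fastforce simp: graph_on_def)
    have "reduction_tree (L + ?I) T'" if "longest_reductions ?V (L + ?I) T'" for T'
    proof (rule longest_reductions_reduction_tree[OF that L])
      fix a v k assume *: "(a, v) \<in># L + ?I" "(v, k) \<in># L + ?I"
      have "\<not> ((a, v) \<in># L \<and> (v, k) \<in># L)"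
        using leaf.hyps[of v] leaf.prems by (fastforce simp: reducible_at_def graph_on_def)
      moreover have "v < Suc i" "k \<le> Suc i"
        using *(2) L unfolding graph_on_def by fastforce+
      then have "(a, v) \<notin># ?I"
        by (auto simp: incoming_def)
      ultimately show "v \<in> ?V \<and> k = Suc i"
        using * by (auto simp: in_nbrs_def incoming_def)
    qed
    then show ?case
      using longest_reductions_exist[OF L, of ?V]
      by (auto intro: extend_tree.leaf elim: extend_tree.cases)
  next
    case (node a j k H T1 T2 T3)
    note g = graph_on_reduct[OF node.prems node.hyps(3,4)]
    note IH = node.IH(1)[OF g(1)] node.IH(2)[OF g(2)] node.IH(3)[OF g(3)]
    have "reduction_tree (H + ?I) T'" if T: "extend_tree ?V ?I (Node H T1 T2 T3) T'" for T'
    proof -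
      obtain T1' T2' T3' where T': "T' = Node (H + ?I) T1' T2' T3'"
        and "extend_tree ?V ?I T1 T1'" "extend_tree ?V ?I T2 T2'" "extend_tree ?V ?I T3 T3'"
        using T by (auto elim: extend_tree.cases)
      then have "reduction_tree (reduct1 H a j k + ?I) T1'"
        "reduction_tree (reduct2 H a j k + ?I) T2'" "reduction_tree (reduct3 H a j k + ?I) T3'"
        using IH by blast+
      then show ?thesis
        unfolding T' using node.hyps(1-4)
        by (intro reduction_tree.node[of a j k]) (simp_all add: reduct_add)
    qed
    then show ?case
      using IH by (blast intro: extend_tree.node)
  qed
  then show "\<exists>T'. extend_tree ?V ?I T T'"
    and "extend_tree ?V ?I T T' \<Longrightarrow> reduction_tree (H + ?I) T'"
    by auto
qed

lemma restrict_graph_Suc: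
  assumes "graph_on n G"
  shows "restrict_graph G (Suc i) = restrict_graph G i + incoming G (Suc i)"
proof -
  have "filter_mset (\<lambda>e. fst e \<le> Suc i \<and> snd e \<le> Suc i) G =
      filter_mset (\<lambda>e. (fst e \<le> i \<and> snd e \<le> i) \<or> snd e = Suc i) G"
    using assms by (intro filter_mset_cong) (auto simp: graph_on_def le_Suc_eq)
  also have "\<dots> = restrict_graph G i + incoming G (Suc i)"
    unfolding restrict_graph_def incoming_def
    by (induction G) auto
  finally show ?thesis
    by (simp add: restrict_graph_def)
qed

lemma restrict_graph_self: "graph_on n G \<Longrightarrow> restrict_graph G n = G"
  by (auto simp: restrict_graph_def graph_on_def filter_mset_eq_conv)

lemma graph_on_restrict: "graph_on n G \<Longrightarrow> graph_on i (restrict_graph G i)"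
  by (auto simp: graph_on_def restrict_graph_def)

lemma specific_tree_reduction_tree:
  assumes "graph_on n G" "specific_tree G i T"
  shows "reduction_tree (restrict_graph G i) T"
  using assms(2)
proof (induction rule: specific_tree.induct)
  case (base i)
  then show ?case
    by (auto intro!: reduction_tree.leaf simp: reducible_at_def restrict_graph_def)
next
  case (step i T T')
  then show ?case
    using extend_tree_reduction_tree(2)[OF step.IH graph_on_restrict[OF assms(1)] assms(1)]
    by (simp add: restrict_graph_Suc[OF assms(1)])
qed

lemma specific_tree_is_reduction_tree:
  "graph_on n G \<Longrightarrow> specific_tree G n T \<Longrightarrow> reduction_tree G T"
  by (metis specific_tree_reduction_tree restrict_graph_self)

lemma specific_tree_exists:
  assumes "graph_on n G"
  shows "\<exists>T. specific_tree G n T"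
proof -
  have "\<exists>T. specific_tree G i T" for i
  proof (induction i)
    case 0
    then show ?case
      by (blast intro: specific_tree.base)
  next
    case (Suc i)
    then obtain T where T: "specific_tree G i T"
      by blast
    show ?case
    proof (cases "i = 0")
      case True
      then show ?thesis
        using specific_tree.base[of "Suc 0" G] by auto
    next
      case False
      then show ?thesis
        using T extend_tree_reduction_tree(1)[OF specific_tree_reduction_tree[OF assms T]
            graph_on_restrict[OF assms] assms]
        by (metis specific_tree.step One_nat_def Suc_leI neq0_conv)
    qed
  qed
  then show ?thesis
    by blast
qed

end

theory Submission
  imports Defs
begin

text \<open>
  All leaves with the same left-degree sequence contribute the same sign, so the exponents of the
  left-degree polynomial are exactly the left-degree sequences. Record the number of lost edges of a
  graph in an additional coordinate \<open>0\<close>. Starting from the degree sequence of \<open>G\<close>, the reductions at a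
  vertex \<open>k\<close> that has \<open>c > 0\<close> edges to the new vertex \<open>N\<close> amount to moving at most \<open>c\<close> units from
  coordinate \<open>k\<close> to coordinate \<open>0\<close>, and then any number of units from \<open>k\<close> to \<open>N\<close>. Moving at most one
  unit from \<open>p\<close> to \<open>q\<close> turns the set of integer bases of a polymatroid \<open>f\<close> into the set of integer
  bases of the polymatroid that sends \<open>I\<close> to \<open>min (f I + 1) (f (I \<union> {p}))\<close> if \<open>q \<in> I\<close>, and to \<open>f I\<close>
  otherwise. Hence the extended degree sequences of the leaves are the integer bases of a polymatroid.
  Saturation follows at once, and fixing the coordinate \<open>0\<close> leaves an integral base polytope, which
  is a generalized permutahedron.
\<close>

section \<open>Integer bases of polymatroids\<close>

definition polymatroid :: "'a set \<Rightarrow> ('a set \<Rightarrow> nat) \<Rightarrow> bool" where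
  "polymatroid E f \<longleftrightarrow> f {} = 0 \<and> (\<forall>I J. I \<subseteq> J \<longrightarrow> J \<subseteq> E \<longrightarrow> f I \<le> f J) \<and>
     (\<forall>I J. I \<subseteq> E \<longrightarrow> J \<subseteq> E \<longrightarrow> f (I \<union> J) + f (I \<inter> J) \<le> f I + f J)"

lemma polymatroidD:
  assumes "polymatroid E f"
  shows "f {} = 0" "I \<subseteq> J \<Longrightarrow> J \<subseteq> E \<Longrightarrow> f I \<le> f J"
    "I \<subseteq> E \<Longrightarrow> J \<subseteq> E \<Longrightarrow> f (I \<union> J) + f (I \<inter> J) \<le> f I + f J"
  using assms by (auto simp: polymatroid_def)

definition bases :: "'a set \<Rightarrow> ('a set \<Rightarrow> nat) \<Rightarrow> ('a \<Rightarrow> nat) set" where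
  "bases E f = {x. (\<forall>i. i \<notin> E \<longrightarrow> x i = 0) \<and> (\<forall>I\<subseteq>E. sum x I \<le> f I) \<and> sum x E = f E}"

definition polymatroidal :: "'a set \<Rightarrow> ('a \<Rightarrow> nat) set \<Rightarrow> bool" where
  "polymatroidal E X \<longleftrightarrow> (\<exists>f. polymatroid E f \<and> X = bases E f)"

lemma polymatroidal_singleton:
  assumes "finite E" "\<And>i. i \<notin> E \<Longrightarrow> x i = 0"
  shows "polymatroidal E {x}"
  unfolding polymatroidal_def
proof (intro exI conjI)
  show "polymatroid E (sum x)"
    unfolding polymatroid_def using assms(1)
    by (auto intro!: sum_mono2 intro: finite_subset)
      (metis finite_subset order.refl sum.union_inter)
  show "{x} = bases E (sum x)"
  proof (intro equalityI subsetI)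
    fix y assume y: "y \<in> bases E (sum x)"
    have le: "y i \<le> x i" if "i \<in> E" for i
    proof -
      have "sum y {i} \<le> sum x {i}"
        using y that unfolding bases_def by blast
      then show ?thesis by simp
    qed
    have "y i = x i" for i
    proof (cases "i \<in> E")
      case True
      have "sum y E = sum x E"
        using y by (simp add: bases_def)
      then show ?thesis
        using sum_mono_inv[of y E x] le assms(1) True by blast
    next
      case False
      then show ?thesis using y assms(2) by (simp add: bases_def)
    qed
    then show "y \<in> {x}" by auto
  qed (use assms in \<open>auto simp: bases_def\<close>)
qed

definition exchange :: "'a \<Rightarrow> 'a \<Rightarrow> ('a \<Rightarrow> nat) set \<Rightarrow> ('a \<Rightarrow> nat) set" where
  "exchange p q X = X \<union> {x(p := x p - 1, q := x q + 1) | x. x \<in> X \<and> 0 < x p}"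

lemma sum_upd_exchange:
  fixes x :: "'a \<Rightarrow> nat"
  assumes "finite I" "p \<noteq> q" "0 < x p"
  shows "sum (x(p := x p - 1, q := x q + 1)) I + (if p \<in> I then 1 else 0) =
    sum x I + (if q \<in> I then 1 else 0)"
proof -
  have "sum (x(p := x p - 1, q := x q + 1)) I + (\<Sum>i\<in>I. if i = p then 1 else 0) =
    sum x I + (\<Sum>i\<in>I. if i = q then 1 else 0)"
    unfolding sum.distrib[symmetric] using assms by (intro sum.cong) auto
  then show ?thesis using assms(1) by (simp add: sum.delta')
qed

lemma polymatroid_exchange:
  assumes f: "polymatroid E f" and "p \<in> E"
  shows "polymatroid E (\<lambda>I. if q \<in> I then min (f I + 1) (f (insert p I)) else f I)"
    (is "polymatroid E ?g")
proof -
  note mono = polymatroidD(2)[OF f] and sub = polymatroidD(3)[OF f]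
  have "?g I \<le> ?g J" if "I \<subseteq> J" "J \<subseteq> E" for I J
    using mono[of I J] mono[of "insert p I" "insert p J"] mono[OF _ that(2), of I]
      mono[of I "insert p J"] mono[of J "insert p J"] that assms(2)
    by (force simp: min_def)
  moreover have "?g (I \<union> J) + ?g (I \<inter> J) \<le> ?g I + ?g J" if "I \<subseteq> E" "J \<subseteq> E" for I J
  proof -
    let ?I = "insert p I" and ?J = "insert p J"
    have IJ: "?I \<subseteq> E" "?J \<subseteq> E" using that assms(2) by auto
    have ins: "I \<union> ?J = insert p (I \<union> J)" "?I \<union> J = insert p (I \<union> J)"
      "?I \<union> ?J = insert p (I \<union> J)" "?I \<inter> ?J = insert p (I \<inter> J)" by auto
    have "f (I \<inter> J) \<le> f (?I \<inter> J)" "f (I \<inter> J) \<le> f (I \<inter> ?J)"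
      using that by (auto intro!: mono)
    moreover have "?I \<inter> J = I \<inter> J \<or> ?I \<inter> J = insert p (I \<inter> J)"
      "I \<inter> ?J = I \<inter> J \<or> I \<inter> ?J = insert p (I \<inter> J)" by auto
    ultimately show ?thesis
      using sub[OF that] sub[OF IJ(1) that(2)] sub[OF that(1) IJ(2)] sub[OF IJ] unfolding ins
      by (cases "q \<in> I"; cases "q \<in> J") (auto simp: min_def)
  qed
  ultimately show ?thesis
    unfolding polymatroid_def using polymatroidD(1)[OF f] by auto
qed

lemma polymatroidal_exchange:
  assumes E: "finite E" "p \<in> E" "q \<in> E" "p \<noteq> q" and "polymatroidal E X"
  shows "polymatroidal E (exchange p q X)"
proof -
  obtain f where f: "polymatroid E f" and X: "X = bases E f"
    using assms(5) by (auto simp: polymatroidal_def)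
  note mono = polymatroidD(2)[OF f] and sub = polymatroidD(3)[OF f]
  define g where "g = (\<lambda>I. if q \<in> I then min (f I + 1) (f (insert p I)) else f I)"
  have gE: "g E = f E" using E by (auto simp: g_def insert_absorb)
  have fin: "finite I" if "I \<subseteq> E" for I using that E(1) by (rule finite_subset)
  have "exchange p q X = bases E g"
  proof (intro equalityI subsetI)
    fix y assume "y \<in> exchange p q X"
    then consider "y \<in> bases E f"
      | x where "x \<in> bases E f" "0 < x p" "y = x(p := x p - 1, q := x q + 1)"
      by (auto simp: exchange_def X)
    then show "y \<in> bases E g"
    proof cases
      case 1
      have "f I \<le> g I" if "I \<subseteq> E" for I
        using mono[of I "insert p I"] that E(2) by (auto simp: g_def)
      with 1 gE show ?thesis
        by (auto simp: bases_def intro: order_trans)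
    next
      case 2
      have x: "\<And>I. I \<subseteq> E \<Longrightarrow> sum x I \<le> f I" "sum x E = f E"
        using 2 by (auto simp: bases_def)
      have s: "sum y I + (if p \<in> I then 1 else 0) = sum x I + (if q \<in> I then 1 else 0)"
        if "I \<subseteq> E" for I
        using sum_upd_exchange[of I p q x] fin[OF that] 2 E by simp
      have "sum y I \<le> g I" if I: "I \<subseteq> E" for I
      proof (cases "q \<in> I")
        case True
        have "sum y I \<le> sum y (insert p I)"
          using fin[OF I] by (intro sum_mono2) auto
        also have "\<dots> \<le> f (insert p I)"
          using s[of "insert p I"] x(1)[of "insert p I"] I E True by auto
        finally show ?thesis
          using s[OF I] x(1)[OF I] True by (auto simp: g_def split: if_splits)
      qed (use s[OF I] x(1)[OF I] in \<open>auto simp: g_def split: if_splits\<close>)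
      moreover have "sum y E = g E" using s[of E] x(2) E gE by simp
      moreover have "y i = 0" if "i \<notin> E" for i
        using 2 that E by (auto simp: bases_def)
      ultimately show ?thesis by (auto simp: bases_def)
    qed
  next
    fix y assume "y \<in> bases E g"
    then have y0: "\<And>i. i \<notin> E \<Longrightarrow> y i = 0" and y: "\<And>I. I \<subseteq> E \<Longrightarrow> sum y I \<le> g I" and yE: "sum y E = f E"
      by (auto simp: bases_def gE)
    show "y \<in> exchange p q X"
    proof (cases "y \<in> bases E f")
      case False
      then obtain K where K: "K \<subseteq> E" "f K < sum y K"
        using y0 yE by (auto simp: bases_def not_le)
      have qK: "q \<in> K" and pK: "p \<notin> K" and yK: "sum y K = f K + 1"
        using y[OF K(1)] K by (auto simp: g_def insert_absorb split: if_splits)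
      have "sum y (K - {q}) \<le> f K"
        using y[of "K - {q}"] mono[of "K - {q}" K] K(1) by (force simp: g_def)
      then have yq: "0 < y q"
        using K(2) sum.remove[OF fin[OF K(1)] qK, of y] by simp
      define x where "x = y(q := y q - 1, p := y p + 1)"
      have yx: "y = x(p := x p - 1, q := x q + 1)" "0 < x p"
        using E(4) yq by (auto simp: x_def fun_eq_iff)
      have s: "sum x I + (if q \<in> I then 1 else 0) = sum y I + (if p \<in> I then 1 else 0)"
        if "I \<subseteq> E" for I
        using sum_upd_exchange[of I q p y] fin[OF that] yq E unfolding x_def by auto
      have "sum x I \<le> f I" if I: "I \<subseteq> E" for I
      proof (cases "q \<notin> I \<and> p \<in> I")
        case True
        have "sum y (I \<union> K) + sum y (I \<inter> K) = sum y I + sum y K"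
          using fin[OF I] fin[OF K(1)] by (rule sum.union_inter)
        moreover have "sum y (I \<union> K) \<le> f (I \<union> K)" "sum y (I \<inter> K) \<le> f (I \<inter> K)"
          using y[of "I \<union> K"] y[of "I \<inter> K"] I K True qK by (auto simp: g_def insert_absorb le_infI1)
        ultimately have "sum y I + 1 \<le> f I"
          using sub[OF I K(1)] yK by linarith
        then show ?thesis using s[OF I] True by simp
      next
        case False
        then show ?thesis
          using s[OF I] y[OF I] by (auto simp: g_def insert_absorb split: if_splits)
      qed
      moreover have "sum x E = f E" using s[of E] yE E by simp
      moreover have "x i = 0" if "i \<notin> E" for i
        using y0[OF that] that E by (auto simp: x_def)
      ultimately have "x \<in> X" by (auto simp: bases_def X)
      with yx show ?thesis unfolding exchange_def by blast
    qed (simp add: exchange_def X)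
  qed
  with polymatroid_exchange[OF f E(2), of q] show ?thesis
    unfolding polymatroidal_def g_def by blast
qed

definition transfer :: "'a \<Rightarrow> 'a \<Rightarrow> nat \<Rightarrow> ('a \<Rightarrow> nat) set \<Rightarrow> ('a \<Rightarrow> nat) set" where
  "transfer p q t X = {x(p := x p - s, q := x q + s) | x s. x \<in> X \<and> s \<le> t \<and> s \<le> x p}"

lemma transfer_0 [simp]: "transfer p q 0 X = X"
  by (auto simp: transfer_def)

lemma transfer_Suc:
  assumes "p \<noteq> q"
  shows "transfer p q (Suc t) X = exchange p q (transfer p q t X)"
proof (intro equalityI subsetI)
  fix y assume "y \<in> transfer p q (Suc t) X"
  then obtain x s where xs: "x \<in> X" "s \<le> Suc t" "s \<le> x p" "y = x(p := x p - s, q := x q + s)"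
    by (auto simp: transfer_def)
  show "y \<in> exchange p q (transfer p q t X)"
  proof (cases "s \<le> t")
    case True
    then show ?thesis using xs by (auto simp: transfer_def exchange_def)
  next
    case False
    then have s: "s = Suc t" using xs by simp
    let ?z = "x(p := x p - t, q := x q + t)"
    have "?z \<in> transfer p q t X" using xs s unfolding transfer_def by force
    moreover have "y = ?z(p := ?z p - 1, q := ?z q + 1)" "0 < ?z p"
      using xs s assms by (auto simp: fun_eq_iff)
    ultimately show ?thesis unfolding exchange_def by blast
  qed
next
  fix y assume "y \<in> exchange p q (transfer p q t X)"
  then consider "y \<in> transfer p q t X"
    | z where "z \<in> transfer p q t X" "0 < z p" "y = z(p := z p - 1, q := z q + 1)"
    by (auto simp: exchange_def)
  then show "y \<in> transfer p q (Suc t) X"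
  proof cases
    case 1
    then show ?thesis by (fastforce simp: transfer_def)
  next
    case 2
    then obtain x s where "x \<in> X" "s \<le> t" "s \<le> x p" "z = x(p := x p - s, q := x q + s)"
      by (auto simp: transfer_def)
    with 2 assms have "x \<in> X" "Suc s \<le> Suc t" "Suc s \<le> x p"
      "y = x(p := x p - Suc s, q := x q + Suc s)" by (auto simp: fun_eq_iff)
    then show ?thesis unfolding transfer_def by blast
  qed
qed

lemma polymatroidal_transfer:
  assumes "finite E" "p \<in> E" "q \<in> E" "p \<noteq> q" "polymatroidal E X"
  shows "polymatroidal E (transfer p q t X)"
  using assms by (induction t) (auto simp: transfer_Suc intro: polymatroidal_exchange)

lemma polymatroidal_bound:
  assumes "finite E" "polymatroidal E X"
  obtains M where "\<And>x i. x \<in> X \<Longrightarrow> x i \<le> M"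
proof -
  obtain f where X: "X = bases E f"
    using assms(2) by (auto simp: polymatroidal_def)
  have "x i \<le> f E" if "x \<in> X" for x i
  proof (cases "i \<in> E")
    case True
    then have "x i \<le> sum x E" using assms(1) by (intro member_le_sum) auto
    then show ?thesis using that X by (simp add: bases_def)
  next
    case False
    then show ?thesis using that X by (simp add: bases_def)
  qed
  then show ?thesis using that by blast
qed

section \<open>Left-degree sequences of the leaves\<close>

text \<open>
  From each \<open>k \<in> A\<close>, \<open>d k\<close> units go to the coordinate \<open>0\<close> of lost edges and \<open>e k\<close> units to \<open>N\<close>; \<open>c k\<close>
  is the number of edges from \<open>k\<close> to \<open>N\<close>.
\<close>

definition moved :: "nat set \<Rightarrow> nat \<Rightarrow> (nat \<Rightarrow> nat) \<Rightarrow> (nat \<Rightarrow> nat) \<Rightarrow> (nat \<Rightarrow> nat) \<Rightarrow> nat \<Rightarrow> nat" where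
  "moved A N d e a i = (if i = 0 then a 0 + sum d A else if i = N then a N + sum e A
     else if i \<in> A then a i - (d i + e i) else a i)"

definition moves :: "nat set \<Rightarrow> nat \<Rightarrow> (nat \<Rightarrow> nat) \<Rightarrow> (nat \<Rightarrow> nat) \<Rightarrow> (nat \<Rightarrow> nat) set" where
  "moves A N c a = {moved A N d e a | d e.
     \<forall>k\<in>A. d k \<le> c k \<and> d k + e k \<le> a k \<and> (c k = 0 \<longrightarrow> e k = 0)}"

lemma movesI:
  assumes "\<And>k. k \<in> A \<Longrightarrow> d k \<le> c k \<and> d k + e k \<le> a k \<and> (c k = 0 \<longrightarrow> e k = 0)"
    "x = moved A N d e a"
  shows "x \<in> moves A N c a"
  using assms unfolding moves_def by blast

lemma movesE:
  assumes "x \<in> moves A N c a"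
  obtains d e where "\<And>k. k \<in> A \<Longrightarrow> d k \<le> c k \<and> d k + e k \<le> a k \<and> (c k = 0 \<longrightarrow> e k = 0)"
    "x = moved A N d e a"
  using assms unfolding moves_def by blast

lemma moves_empty [simp]: "moves {} N c a = {a}"
  by (auto simp: moves_def moved_def fun_eq_iff)

lemma moves_cong:
  assumes "\<And>k. k \<in> A \<Longrightarrow> a k = 0 \<or> c k = c' k"
  shows "moves A N c a = moves A N c' a"
proof -
  have "(\<forall>k\<in>A. d k \<le> c k \<and> d k + e k \<le> a k \<and> (c k = 0 \<longrightarrow> e k = 0)) \<longleftrightarrow>
    (\<forall>k\<in>A. d k \<le> c' k \<and> d k + e k \<le> a k \<and> (c' k = 0 \<longrightarrow> e k = 0))" for d e
    using assms by (intro ball_cong refl) fastforce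
  then show ?thesis unfolding moves_def by simp
qed

lemma moves_trivial:
  assumes "\<And>k. k \<in> A \<Longrightarrow> a k = 0 \<or> c k = 0"
  shows "moves A N c a = {a}"
proof (intro equalityI subsetI)
  fix x assume "x \<in> moves A N c a"
  then obtain d e where de: "\<And>k. k \<in> A \<Longrightarrow> d k \<le> c k \<and> d k + e k \<le> a k \<and> (c k = 0 \<longrightarrow> e k = 0)"
    "x = moved A N d e a" by (rule movesE) blast
  then have "d k = 0" "e k = 0" if "k \<in> A" for k
    using assms[OF that] de(1)[OF that] by auto
  then show "x \<in> {a}" by (auto simp: de(2) moved_def fun_eq_iff)
next
  fix x assume "x \<in> {a}"
  then show "x \<in> moves A N c a"
    by (intro movesI[where d = "\<lambda>_. 0" and e = "\<lambda>_. 0"]) (auto simp: moved_def fun_eq_iff)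
qed

lemma sum_fun_upd:
  assumes "finite A" "k \<in> A"
  shows "sum (f(k := v)) A + f k = sum f A + (v :: nat)"
  using assms by (simp add: sum.remove[of A k])

lemma moves_split:
  assumes A: "finite A" "0 \<notin> A" "N \<notin> A" "N \<noteq> 0" and j: "j \<in> A" "0 < a j" "0 < c j"
  shows "moves A N c a = moves A N (c(j := c j - 1)) a \<union>
    moves A N c (a(j := a j - 1, N := a N + 1)) \<union>
    moves A N (c(j := c j - 1)) (a(j := a j - 1, 0 := a 0 + 1))"
    (is "_ = ?M1 \<union> ?M2 \<union> ?M3")
proof (intro equalityI subsetI)
  have j0: "j \<noteq> 0" "j \<noteq> N" using A j by metis+
  fix x assume "x \<in> moves A N c a"
  then obtain d e where de: "\<And>k. k \<in> A \<Longrightarrow> d k \<le> c k \<and> d k + e k \<le> a k \<and> (c k = 0 \<longrightarrow> e k = 0)"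
    "x = moved A N d e a" by (rule movesE) blast
  consider "0 < e j" | "e j = 0" "0 < d j" | "e j = 0" "d j = 0" by auto
  then show "x \<in> ?M1 \<union> ?M2 \<union> ?M3"
  proof cases
    case 1
    then have "x \<in> ?M2"
      using de j j0 A sum_fun_upd[OF A(1) j(1), of e "e j - 1"]
      by (intro movesI[where d = d and e = "e(j := e j - 1)"])
         (force simp: moved_def fun_eq_iff)+
    then show ?thesis by simp
  next
    case 2
    then have "x \<in> ?M3"
      using de j j0 A sum_fun_upd[OF A(1) j(1), of d "d j - 1"]
      by (intro movesI[where d = "d(j := d j - 1)" and e = e])
         (force simp: moved_def fun_eq_iff)+
    then show ?thesis by simp
  next
    case 3
    then have "x \<in> ?M1"
      using de j j0 A
      by (intro movesI[where d = d and e = e])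
         (force simp: moved_def fun_eq_iff)+
    then show ?thesis by simp
  qed
next
  have j0: "j \<noteq> 0" "j \<noteq> N" using A j by metis+
  fix x assume "x \<in> ?M1 \<union> ?M2 \<union> ?M3"
  then consider "x \<in> ?M1" | "x \<in> ?M2" | "x \<in> ?M3" by blast
  then show "x \<in> moves A N c a"
  proof cases
    case 1
    then obtain d e where de: "\<And>k. k \<in> A \<Longrightarrow> d k \<le> (c(j := c j - 1)) k \<and> d k + e k \<le> a k \<and>
      ((c(j := c j - 1)) k = 0 \<longrightarrow> e k = 0)" "x = moved A N d e a" by (rule movesE) blast
    show ?thesis
      by (rule movesI[OF _ de(2)]) (use de(1) j in \<open>fastforce split: if_splits\<close>)
  next
    case 2
    let ?a = "a(j := a j - 1, N := a N + 1)"
    obtain d e where de: "\<And>k. k \<in> A \<Longrightarrow> d k \<le> c k \<and> d k + e k \<le> ?a k \<and>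
      (c k = 0 \<longrightarrow> e k = 0)" "x = moved A N d e ?a" using 2 by (rule movesE) blast
    show ?thesis
    proof (rule movesI[where d = d and e = "e(j := e j + 1)"])
      show "d k \<le> c k \<and> d k + (e(j := e j + 1)) k \<le> a k \<and> (c k = 0 \<longrightarrow> (e(j := e j + 1)) k = 0)"
        if "k \<in> A" for k
        using de(1)[OF that] that j j0 A by (auto split: if_splits)
      show "x = moved A N d (e(j := e j + 1)) a"
        using j j0 A sum_fun_upd[OF A(1) j(1), of e "e j + 1"]
        by (auto simp: de(2) moved_def fun_eq_iff)
    qed
  next
    case 3
    let ?a = "a(j := a j - 1, 0 := a 0 + 1)" and ?c = "c(j := c j - 1)"
    obtain d e where de: "\<And>k. k \<in> A \<Longrightarrow> d k \<le> ?c k \<and> d k + e k \<le> ?a k \<and>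
      (?c k = 0 \<longrightarrow> e k = 0)" "x = moved A N d e ?a" using 3 by (rule movesE) blast
    show ?thesis
    proof (rule movesI[where d = "d(j := d j + 1)" and e = e])
      show "(d(j := d j + 1)) k \<le> c k \<and> (d(j := d j + 1)) k + e k \<le> a k \<and> (c k = 0 \<longrightarrow> e k = 0)"
        if "k \<in> A" for k
        using de(1)[OF that] that j j0 A by (auto split: if_splits)
      show "x = moved A N (d(j := d j + 1)) e a"
        using j j0 A sum_fun_upd[OF A(1) j(1), of d "d j + 1"]
        by (auto simp: de(2) moved_def fun_eq_iff)
    qed
  qed
qed

lemma moves_insert:
  assumes A: "finite A" "k \<notin> A" "0 \<notin> insert k A" "N \<notin> insert k A" "N \<noteq> 0"
  shows "x \<in> moves (insert k A) N c a \<longleftrightarrow> (\<exists>y\<in>moves A N c a. \<exists>s t. s \<le> c k \<and> s + t \<le> y k \<and>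
    (c k = 0 \<longrightarrow> t = 0) \<and> x = y(k := y k - (s + t), 0 := y 0 + s, N := y N + t))"
proof
  have k0: "k \<noteq> 0" "k \<noteq> N" using A by auto
  assume "x \<in> moves (insert k A) N c a"
  then obtain d e where de: "\<And>j. j \<in> insert k A \<Longrightarrow> d j \<le> c j \<and> d j + e j \<le> a j \<and> (c j = 0 \<longrightarrow> e j = 0)"
    "x = moved (insert k A) N d e a" by (rule movesE) blast
  let ?y = "moved A N d e a"
  have "?y \<in> moves A N c a"
    by (rule movesI[where d = d and e = e]) (use de(1) in auto)
  moreover have "?y k = a k" using A k0 by (auto simp: moved_def)
  moreover have "x = ?y(k := ?y k - (d k + e k), 0 := ?y 0 + d k, N := ?y N + e k)"
    using A k0 by (auto simp: moved_def fun_eq_iff de(2))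
  ultimately show "\<exists>y\<in>moves A N c a. \<exists>s t. s \<le> c k \<and> s + t \<le> y k \<and>
    (c k = 0 \<longrightarrow> t = 0) \<and> x = y(k := y k - (s + t), 0 := y 0 + s, N := y N + t)"
    using de(1)[of k] by (metis insertI1)
next
  have k0: "k \<noteq> 0" "k \<noteq> N" using A by auto
  assume "\<exists>y\<in>moves A N c a. \<exists>s t. s \<le> c k \<and> s + t \<le> y k \<and>
    (c k = 0 \<longrightarrow> t = 0) \<and> x = y(k := y k - (s + t), 0 := y 0 + s, N := y N + t)"
  then obtain y s t where y: "y \<in> moves A N c a" "s \<le> c k" "s + t \<le> y k"
    "c k = 0 \<longrightarrow> t = 0" "x = y(k := y k - (s + t), 0 := y 0 + s, N := y N + t)"
    by (elim bexE exE conjE) (rule that)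
  obtain d e where de: "\<And>j. j \<in> A \<Longrightarrow> d j \<le> c j \<and> d j + e j \<le> a j \<and> (c j = 0 \<longrightarrow> e j = 0)"
    "y = moved A N d e a" using y(1) by (rule movesE) blast
  have yk: "y k = a k" using A k0 by (auto simp: moved_def de(2))
  have s: "sum (d(k := s)) A = sum d A" "sum (e(k := t)) A = sum e A"
    using A(2) by (auto intro: sum.cong)
  show "x \<in> moves (insert k A) N c a"
  proof (rule movesI[where d = "d(k := s)" and e = "e(k := t)"])
    show "x = moved (insert k A) N (d(k := s)) (e(k := t)) a"
      using A k0 s by (auto simp: moved_def fun_eq_iff de(2) y(5))
  qed (use de(1) y yk in auto)
qed

lemma polymatroidal_moves:
  assumes "finite E" "A \<subseteq> E" "0 \<in> E" "N \<in> E" "0 \<notin> A" "N \<notin> A" "N \<noteq> 0" "polymatroidal E X"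
  shows "polymatroidal E (\<Union>a\<in>X. moves A N c a)"
proof -
  have "finite A" using assms(1,2) by (rule finite_subset[rotated])
  then show ?thesis using assms(2,5,6)
  proof (induction A rule: finite_induct)
    case empty
    then show ?case using assms(8) by simp
  next
    case (insert k A)
    define Y where "Y = (\<Union>a\<in>X. moves A N c a)"
    have Y: "polymatroidal E Y" using insert unfolding Y_def by auto
    have k: "k \<in> E" "k \<noteq> 0" "k \<noteq> N" using insert.prems by auto
    have mem: "x \<in> (\<Union>a\<in>X. moves (insert k A) N c a) \<longleftrightarrow> (\<exists>y\<in>Y. \<exists>s t. s \<le> c k \<and> s + t \<le> y k \<and>
      (c k = 0 \<longrightarrow> t = 0) \<and> x = y(k := y k - (s + t), 0 := y 0 + s, N := y N + t))" for x
      using moves_insert[of A k N x c] insert.hyps insert.prems assms(7) unfolding Y_def by simp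
    show ?case
    proof (cases "c k = 0")
      case True
      then have "(\<Union>a\<in>X. moves (insert k A) N c a) = Y"
        by (subst set_eq_iff, unfold mem) (auto simp: fun_upd_idem)
      then show ?thesis using Y by simp
    next
      case False
      let ?Z = "transfer k 0 (c k) Y"
      have Z: "polymatroidal E ?Z"
        using assms k Y by (intro polymatroidal_transfer) auto
      obtain M where M: "\<And>x i. x \<in> ?Z \<Longrightarrow> x i \<le> M"
        using polymatroidal_bound[OF assms(1) Z] by blast
      have "(\<Union>a\<in>X. moves (insert k A) N c a) = transfer k N M ?Z"
      proof (intro equalityI subsetI)
        fix x assume "x \<in> (\<Union>a\<in>X. moves (insert k A) N c a)"
        then obtain y s t where y: "y \<in> Y" "s \<le> c k" "s + t \<le> y k"
          "x = y(k := y k - (s + t), 0 := y 0 + s, N := y N + t)" using mem by blast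
        let ?z = "y(k := y k - s, 0 := y 0 + s)"
        have "s \<le> y k" using y(3) by simp
        then have z: "?z \<in> ?Z" using y(1,2) unfolding transfer_def by blast
        have "t \<le> ?z k" "x = ?z(k := ?z k - t, N := ?z N + t)"
          using y k assms(7) by (auto simp: fun_eq_iff)
        moreover from this have "t \<le> M" using M[OF z, of k] by linarith
        ultimately show "x \<in> transfer k N M ?Z" using z unfolding transfer_def[of k N] by blast
      next
        fix x assume "x \<in> transfer k N M ?Z"
        then obtain z t where z: "z \<in> ?Z" "t \<le> z k" "x = z(k := z k - t, N := z N + t)"
          by (auto simp: transfer_def[of k N])
        then obtain y s where y: "y \<in> Y" "s \<le> c k" "s \<le> y k" "z = y(k := y k - s, 0 := y 0 + s)"
          by (auto simp: transfer_def)
        have "s + t \<le> y k" "x = y(k := y k - (s + t), 0 := y 0 + s, N := y N + t)"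
          using y z k assms(7) by (auto simp: fun_eq_iff)
        then show "x \<in> (\<Union>a\<in>X. moves (insert k A) N c a)"
          unfolding mem using y(1,2) False
            by (intro bexI[of _ y] exI[of _ s] exI[of _ t]) simp_all
      qed
      then show ?thesis
        using assms k Z by (simp add: polymatroidal_transfer)
    qed
  qed
qed

definition degree_vector :: "nat \<Rightarrow> graph \<Rightarrow> nat \<Rightarrow> nat" where
  "degree_vector s L i = (if i = 0 then s - size L else indeg L i)"

lemma indeg_union [simp]: "indeg (A + B) i = indeg A i + indeg B i"
  by (simp add: indeg_def)

lemma indeg_empty [simp]: "indeg {#} i = 0"
  by (simp add: indeg_def)

lemma indeg_add_mset [simp]: "indeg (add_mset e A) i = (if snd e = i then 1 else 0) + indeg A i"
  by (simp add: indeg_def)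

lemma indeg_eq_0_iff: "indeg A i = 0 \<longleftrightarrow> (\<forall>e\<in>#A. snd e \<noteq> i)"
  by (induction A) auto

lemma longest_reductions_leaves:
  assumes "longest_reductions V H T" "0 < N" "graph_on N H"
    and "\<And>a v b. (a, v) \<in># H \<Longrightarrow> (v, b) \<in># H \<Longrightarrow> v \<in> V \<and> b = N"
    and R: "\<And>e. e \<in># R \<Longrightarrow> N < snd e"
    and "size (H + R) \<le> s"
  shows "(\<lambda>L. degree_vector s (L + R)) ` set_mset (leaves T) =
    moves {1..<N} N (\<lambda>k. count H (k, N)) (degree_vector s (H + R))"
  using assms(1,3,4,6)
proof (induction rule: longest_reductions.induct)
  case (stop H)
  have "degree_vector s (H + R) k = 0 \<or> count H (k, N) = 0" if "k \<in> {1..<N}" for k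
  proof (rule ccontr)
    assume "\<not> ?thesis"
    then have "indeg H k + indeg R k \<noteq> 0" and kN: "(k, N) \<in># H"
      using that by (auto simp: degree_vector_def)
    moreover have "indeg R k = 0" using R that by (fastforce simp: indeg_eq_0_iff)
    ultimately obtain a where "(a, k) \<in># H" by (auto simp: indeg_eq_0_iff)
    moreover from this have "a < k" using stop.prems(1) by (auto simp: graph_on_def)
    ultimately show False
      using stop.hyps[of k] stop.prems(2)[of a k N] kN that by (auto simp: reducible_at_def)
  qed
  then show ?case by (subst moves_trivial) auto
next
  case (reduce j i k H T1 T2 T3)
  have e: "(i, j) \<in># H" "(j, k) \<in># H"
    using reduce.hyps by (auto simp: longest_in_def longest_out_def)
  have kN: "k = N" using reduce.prems(2)[OF e] by simp
  have no: "(b, i) \<notin># H" for b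
    using reduce.prems(2)[of b i j] e(1) \<open>j < k\<close> kN by blast
  have no': "(k, b) \<notin># H" for b
    using reduce.prems(1) kN by (fastforce simp: graph_on_def)
  have inv: "v \<in> V \<and> c = N"
    if "\<And>x. x \<in># H' \<Longrightarrow> x \<in># H \<or> x = (i, k)" "(a, v) \<in># H'" "(v, c) \<in># H'" for H' a v c
  proof -
    have "(a, v) \<in># H"
      using that(1)[OF that(2)] that(1)[OF that(3)] no' \<open>i < j\<close> \<open>j < k\<close> by auto
    moreover from this have "(v, c) \<in># H"
      using that(1)[OF that(3)] no by auto
    ultimately show ?thesis using reduce.prems(2) by blast
  qed
  obtain M where M: "H = {#(i, j), (j, N)#} + M"
    using mset_pair_subset[OF e] \<open>i < j\<close> kN by (auto simp: mset_subset_eq_exists_conv)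
  have red: "reduct1 H i j k = {#(i, N), (i, j)#} + M"
    "reduct2 H i j k = {#(i, N), (j, N)#} + M" "reduct3 H i j k = {#(i, N)#} + M"
    using \<open>i < j\<close> kN by (auto simp: M reduct1_def reduct2_def reduct3_def)
  define a where "a = degree_vector s (H + R)"
  define c where "c = (\<lambda>k. count H (k, N))"
  have cM: "c = (\<lambda>l. count ({#(i, j), (j, N)#} + M) (l, N))" by (simp add: c_def M)
  have a1: "degree_vector s (reduct1 H i j k + R) = a"
    and a2: "degree_vector s (reduct2 H i j k + R) = a(j := a j - 1, N := a N + 1)"
    and a3: "degree_vector s (reduct3 H i j k + R) = a(j := a j - 1, 0 := a 0 + 1)"
    unfolding red a_def using \<open>i < j\<close> \<open>j < k\<close> kN reduce.prems(3)
    by (auto simp: M degree_vector_def fun_eq_iff)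
  \<comment> \<open>so the new edge \<open>(i, N)\<close> does not affect the moves\<close>
  have ai: "a i = 0" if "0 < i"
    using that no R \<open>i < j\<close> \<open>j < k\<close> kN
    by (fastforce simp: a_def degree_vector_def indeg_eq_0_iff)
  have sz: "size (reduct1 H i j k + R) \<le> s" "size (reduct2 H i j k + R) \<le> s"
    "size (reduct3 H i j k + R) \<le> s"
    using reduce.prems(3) unfolding red by (auto simp: M)
  note g = graph_on_reduct[OF reduce.prems(1) e]
  let ?F = "\<lambda>T. (\<lambda>L. degree_vector s (L + R)) ` set_mset (leaves T)"
  have "?F T1 = moves {1..<N} N (\<lambda>l. count (reduct1 H i j k) (l, N)) a"
    unfolding a1[symmetric] by (rule reduce.IH(1)[OF g(1) inv[OF reduct_mem(1)] sz(1)])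
  also have "\<dots> = moves {1..<N} N (c(j := c j - 1)) a"
    using ai \<open>i < j\<close> \<open>j < k\<close> kN by (intro moves_cong) (auto simp: red[unfolded kN] cM)
  finally have 1: "?F T1 = \<dots>" .
  have "?F T2 = moves {1..<N} N (\<lambda>l. count (reduct2 H i j k) (l, N)) (a(j := a j - 1, N := a N + 1))"
    unfolding a2[symmetric] by (rule reduce.IH(2)[OF g(2) inv[OF reduct_mem(2)] sz(2)])
  also have "\<dots> = moves {1..<N} N c (a(j := a j - 1, N := a N + 1))"
    using ai \<open>i < j\<close> \<open>j < k\<close> kN by (intro moves_cong) (auto simp: red[unfolded kN] cM)
  finally have 2: "?F T2 = \<dots>" .
  have "?F T3 = moves {1..<N} N (\<lambda>l. count (reduct3 H i j k) (l, N)) (a(j := a j - 1, 0 := a 0 + 1))"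
    unfolding a3[symmetric] by (rule reduce.IH(3)[OF g(3) inv[OF reduct_mem(3)] sz(3)])
  also have "\<dots> = moves {1..<N} N (c(j := c j - 1)) (a(j := a j - 1, 0 := a 0 + 1))"
    using ai \<open>i < j\<close> \<open>j < k\<close> kN by (intro moves_cong) (auto simp: red[unfolded kN] cM)
  finally have 3: "?F T3 = \<dots>" .
  have "moves {1..<N} N c a = ?F T1 \<union> ?F T2 \<union> ?F T3"
    unfolding 1 2 3 using \<open>i < j\<close> \<open>j < k\<close> kN
    by (intro moves_split) (auto simp: a_def c_def M degree_vector_def)
  then show ?case by (simp add: image_Un a_def c_def)
qed

lemma reduction_tree_leaves:
  assumes "reduction_tree H T" "graph_on N H" "L \<in># leaves T"
  shows "graph_on N L \<and> (\<forall>j. \<not> reducible_at L j) \<and> size L \<le> size H"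
  using assms
proof (induction rule: reduction_tree.induct)
  case (node i j k H T1 T2 T3)
  note g = graph_on_reduct[OF node.prems(1) node.hyps(3,4)]
  obtain M where M: "H = {#(i, j), (j, k)#} + M"
    using mset_pair_subset[OF node.hyps(3,4)] \<open>i < j\<close> by (auto simp: mset_subset_eq_exists_conv)
  have "size (reduct1 H i j k) \<le> size H" "size (reduct2 H i j k) \<le> size H"
    "size (reduct3 H i j k) \<le> size H"
    using \<open>i < j\<close> by (auto simp: M reduct1_def reduct2_def reduct3_def)
  then show ?case
    using node.IH(1)[OF g(1)] node.IH(2)[OF g(2)] node.IH(3)[OF g(3)] node.prems(2) by fastforce
qed simp

lemma extend_tree_leaves:
  assumes "extend_tree V I T T'"
    and "\<And>L U. L \<in># leaves T \<Longrightarrow> longest_reductions V (L + I) U \<Longrightarrow>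
      F ` set_mset (leaves U) = \<Phi> L"
  shows "F ` set_mset (leaves T') = (\<Union>L\<in>set_mset (leaves T). \<Phi> L)"
  using assms by (induction rule: extend_tree.induct) (auto simp: image_Un)

lemma restrict_graph_plus:
  assumes "graph_on n G"
  shows "restrict_graph G i + filter_mset (\<lambda>e. i < snd e) G = G"
proof -
  have "restrict_graph G i = filter_mset (\<lambda>e. \<not> i < snd e) G"
    unfolding restrict_graph_def using assms
    by (intro filter_mset_cong) (auto simp: graph_on_def)
  then show ?thesis by (metis multiset_partition add.commute)
qed

lemma specific_tree_polymatroidal:
  assumes G: "graph_on n G" and "specific_tree G i T" "i \<le> n"
  shows "polymatroidal {0..n}
    ((\<lambda>L. degree_vector (size G) (L + filter_mset (\<lambda>e. i < snd e) G)) ` set_mset (leaves T))"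
  using assms(2,3)
proof (induction rule: specific_tree.induct)
  case (base i)
  have "degree_vector (size G) G k = 0" if "k \<notin> {0..n}" for k
    using G that by (fastforce simp: degree_vector_def indeg_eq_0_iff graph_on_def)
  then show ?case
    using polymatroidal_singleton[of "{0..n}" "degree_vector (size G) G"]
    by (simp add: restrict_graph_plus[OF G])
next
  case (step i T T')
  let ?N = "Suc i" and ?I = "incoming G (Suc i)" and ?V = "in_nbrs G (Suc i)"
  let ?R = "\<lambda>i. filter_mset (\<lambda>e. i < snd e) G"
  let ?v = "\<lambda>i L. degree_vector (size G) (L + ?R i)"
  define c where "c = (\<lambda>k. count G (k, ?N))"
  have RI: "?R i = ?I + ?R ?N"
    unfolding incoming_def by (induction G) auto
  have "?v ?N ` set_mset (leaves U) = moves {1..<?N} ?N c (?v i L)"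
    if L: "L \<in># leaves T" and U: "longest_reductions ?V (L + ?I) U" for L U
  proof -
    have leaf: "graph_on i L" "\<And>j. \<not> reducible_at L j" "size L \<le> size (restrict_graph G i)"
      using reduction_tree_leaves[OF specific_tree_reduction_tree[OF G step.hyps(2)]
          graph_on_restrict[OF G] L] by auto
    have g: "graph_on ?N (L + ?I)"
      using leaf(1) graph_on_incoming[OF G, of ?N] by (fastforce simp: graph_on_def)
    have inv: "v \<in> ?V \<and> k = ?N" if *: "(a, v) \<in># L + ?I" "(v, k) \<in># L + ?I" for a v k
    proof -
      have "\<not> ((a, v) \<in># L \<and> (v, k) \<in># L)"
        using leaf(1) leaf(2)[of v] by (fastforce simp: reducible_at_def graph_on_def)
      moreover have "v < ?N" using *(2) g unfolding graph_on_def by fastforce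
      then have "(a, v) \<notin># ?I" by (auto simp: incoming_def)
      ultimately show ?thesis using * by (auto simp: in_nbrs_def incoming_def)
    qed
    have "size (L + ?I + ?R ?N) \<le> size G"
      using leaf(3) arg_cong[OF restrict_graph_plus[OF G, of i], of size] RI by simp
    then have "?v ?N ` set_mset (leaves U) =
      moves {1..<?N} ?N (\<lambda>k. count (L + ?I) (k, ?N)) (degree_vector (size G) (L + ?I + ?R ?N))"
      by (intro longest_reductions_leaves[OF U _ g inv]) auto
    moreover have "(\<lambda>k. count (L + ?I) (k, ?N)) = c"
    proof
      fix k
      have "(k, ?N) \<notin># L" using leaf(1) by (auto simp: graph_on_def)
      then show "count (L + ?I) (k, ?N) = c k"
        by (simp add: c_def incoming_def not_in_iff)
    qed
    ultimately show ?thesis by (simp add: RI add.assoc)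
  qed
  then have "?v ?N ` set_mset (leaves T') = (\<Union>L\<in>set_mset (leaves T). moves {1..<?N} ?N c (?v i L))"
    by (rule extend_tree_leaves[OF step.hyps(3)])
  also have "\<dots> = (\<Union>a\<in>?v i ` set_mset (leaves T). moves {1..<?N} ?N c a)" by simp
  also have "polymatroidal {0..n} \<dots>"
    using step.IH step.prems by (intro polymatroidal_moves) auto
  finally show ?case .
qed

section \<open>Integrality of base polytopes\<close>

lemma lookup_scaleR [simp]:
  "Poly_Mapping.lookup (r *\<^sub>R x) i = r *\<^sub>R Poly_Mapping.lookup x i"
proof -
  have "{i. r *\<^sub>R Poly_Mapping.lookup x i \<noteq> 0} \<subseteq> Poly_Mapping.keys x"
    by (auto simp: in_keys_iff)
  then have "finite {i. r *\<^sub>R Poly_Mapping.lookup x i \<noteq> 0}"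
    by (rule finite_subset) simp
  then show ?thesis by (simp add: scaleR_poly_mapping_def)
qed

lemma keys_scaleR_add:
  "Poly_Mapping.keys (u *\<^sub>R x + v *\<^sub>R y) \<subseteq> Poly_Mapping.keys x \<union> Poly_Mapping.keys y"
  by (auto simp: in_keys_iff lookup_add)

definition base_polytope :: "'a set \<Rightarrow> ('a set \<Rightarrow> real) \<Rightarrow> ('a \<Rightarrow>\<^sub>0 real) set" where
  "base_polytope E g = {t. Poly_Mapping.keys t \<subseteq> E \<and>
     (\<forall>I\<subseteq>E. sum (Poly_Mapping.lookup t) I \<le> g I) \<and> sum (Poly_Mapping.lookup t) E = g E}"

lemma sum_lookup_exchange:
  fixes t :: real
  assumes "finite I"
  shows "sum (Poly_Mapping.lookup (x + t *\<^sub>R (Poly_Mapping.single i 1 - Poly_Mapping.single j 1))) I =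
    sum (Poly_Mapping.lookup x) I + t * (of_bool (i \<in> I) - of_bool (j \<in> I))"
proof -
  have "sum (Poly_Mapping.lookup (x + t *\<^sub>R (Poly_Mapping.single i 1 - Poly_Mapping.single j 1))) I =
    (\<Sum>l\<in>I. Poly_Mapping.lookup x l + ((if l = i then t else 0) - (if l = j then t else 0)))"
    by (intro sum.cong) (auto simp: lookup_add lookup_minus lookup_single when_def)
  also have "\<dots> = sum (Poly_Mapping.lookup x) I + t * (of_bool (i \<in> I) - of_bool (j \<in> I))"
    using assms by (simp add: sum.distrib sum_subtractf)
  finally show ?thesis .
qed

text \<open>The point \<open>y\<close> is where the first new set becomes tight.\<close>

lemma base_polytope_move:
  fixes g :: "'a set \<Rightarrow> real"
  assumes "finite E" "x \<in> base_polytope E g" "i \<in> E" "j \<in> E" "i \<noteq> j"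
    and tight: "\<And>I. I \<subseteq> E \<Longrightarrow> sum (Poly_Mapping.lookup x) I = g I \<Longrightarrow> i \<in> I \<longleftrightarrow> j \<in> I"
  obtains t y where "0 < t" "y = x + t *\<^sub>R (Poly_Mapping.single i 1 - Poly_Mapping.single j 1)"
    "y \<in> base_polytope E g"
    "{I. I \<subseteq> E \<and> sum (Poly_Mapping.lookup y) I \<noteq> g I} \<subset>
     {I. I \<subseteq> E \<and> sum (Poly_Mapping.lookup x) I \<noteq> g I}"
proof -
  let ?s = "\<lambda>x. sum (Poly_Mapping.lookup x)"
  have x: "Poly_Mapping.keys x \<subseteq> E" "\<And>I. I \<subseteq> E \<Longrightarrow> ?s x I \<le> g I" "?s x E = g E"
    using assms(2) by (auto simp: base_polytope_def)
  define \<F> where "\<F> = {I. I \<subseteq> E \<and> i \<in> I \<and> j \<notin> I}"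
  define t where "t = Min ((\<lambda>I. g I - ?s x I) ` \<F>)"
  define y where "y = x + t *\<^sub>R (Poly_Mapping.single i 1 - Poly_Mapping.single j 1)"
  have fin: "finite \<F>" using assms(1) by (auto simp: \<F>_def)
  have ne: "{i} \<in> \<F>" using assms by (auto simp: \<F>_def)
  have "t \<in> (\<lambda>I. g I - ?s x I) ` \<F>"
    unfolding t_def using fin ne by (intro Min_in) auto
  then obtain K where K: "K \<in> \<F>" "t = g K - ?s x K" by blast
  have tle: "t \<le> g I - ?s x I" if "I \<in> \<F>" for I
    unfolding t_def using fin that by (intro Min_le) auto
  have pos: "0 < t"
    using K x(2)[of K] tight[of K] by (force simp: \<F>_def)
  have s: "?s y I = ?s x I + t * (of_bool (i \<in> I) - of_bool (j \<in> I))" if "I \<subseteq> E" for I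
    unfolding y_def using assms(1) that by (intro sum_lookup_exchange) (rule finite_subset)
  have "?s y I \<le> g I" if "I \<subseteq> E" for I
    using s[OF that] x(2)[OF that] tle[of I] pos that
    by (cases "i \<in> I"; cases "j \<in> I") (auto simp: \<F>_def)
  moreover have "Poly_Mapping.keys y \<subseteq> E"
  proof
    fix l assume "l \<in> Poly_Mapping.keys y"
    then show "l \<in> E"
      using x(1) assms(3,4)
      by (cases "l = i"; cases "l = j")
        (auto simp: y_def in_keys_iff lookup_add lookup_minus lookup_single when_def)
  qed
  ultimately have y: "y \<in> base_polytope E g"
    using s[of E] x(3) assms(3,4) by (auto simp: base_polytope_def)
  have "{I. I \<subseteq> E \<and> ?s y I \<noteq> g I} \<subseteq> {I. I \<subseteq> E \<and> ?s x I \<noteq> g I}"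
    using s tight by auto
  moreover have "K \<in> {I. I \<subseteq> E \<and> ?s x I \<noteq> g I}" "K \<notin> {I. I \<subseteq> E \<and> ?s y I \<noteq> g I}"
    using K pos s[of K] by (auto simp: \<F>_def)
  ultimately have "{I. I \<subseteq> E \<and> ?s y I \<noteq> g I} \<subset> {I. I \<subseteq> E \<and> ?s x I \<noteq> g I}"
    by blast
  with pos y that[of t y] show ?thesis unfolding y_def by blast
qed

lemma base_polytope_integral:
  fixes g :: "'a set \<Rightarrow> real"
  assumes E: "finite E" and g: "\<And>I. I \<subseteq> E \<Longrightarrow> g I \<in> \<int>"
    and sub: "\<And>I J. I \<subseteq> E \<Longrightarrow> J \<subseteq> E \<Longrightarrow> g (I \<union> J) + g (I \<inter> J) \<le> g I + g J"
  shows "base_polytope E g \<subseteq>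
    convex hull {t \<in> base_polytope E g. \<forall>i. Poly_Mapping.lookup t i \<in> \<int>}" (is "_ \<subseteq> ?H")
proof
  let ?s = "\<lambda>x. sum (Poly_Mapping.lookup x)"
  fix x assume "x \<in> base_polytope E g"
  then show "x \<in> ?H"
  proof (induction "card {I. I \<subseteq> E \<and> ?s x I \<noteq> g I}" arbitrary: x rule: less_induct)
    case less
    have x: "Poly_Mapping.keys x \<subseteq> E" "\<And>I. I \<subseteq> E \<Longrightarrow> ?s x I \<le> g I" "?s x E = g E"
      using less.prems by (auto simp: base_polytope_def)
    show ?case
    proof (cases "\<forall>i. Poly_Mapping.lookup x i \<in> \<int>")
      case True
      with less.prems show ?thesis by (intro hull_inc) auto
    next
      case False
      \<comment> \<open>A minimal tight set with a non-integral coordinate has two of them, since its sum is integral,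
        and by uncrossing no tight set separates them.\<close>
      let ?tight = "\<lambda>I. I \<subseteq> E \<and> ?s x I = g I"
      let ?frac = "\<lambda>I. \<exists>i\<in>I. Poly_Mapping.lookup x i \<notin> \<int>"
      from False obtain i0 where i0: "Poly_Mapping.lookup x i0 \<notin> \<int>" by blast
      then have "i0 \<in> E" using x(1) by (metis Ints_0 in_keys_iff subsetD)
      then have "?tight E \<and> ?frac E" using i0 x(3) by blast
      then obtain K where K: "?tight K" "?frac K"
        and Kmin: "\<And>I. ?tight I \<and> ?frac I \<Longrightarrow> card K \<le> card I"
        using arg_min_nat_lemma[of "\<lambda>I. ?tight I \<and> ?frac I" E card] by blast
      have finK: "finite K" using K E finite_subset by blast
      obtain i where i: "i \<in> K" "Poly_Mapping.lookup x i \<notin> \<int>" using K by blast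
      have "\<exists>j\<in>K - {i}. Poly_Mapping.lookup x j \<notin> \<int>"
      proof (rule ccontr)
        assume "\<not> ?thesis"
        then have "?s x (K - {i}) \<in> \<int>" by (intro Ints_sum) auto
        moreover have "?s x K = Poly_Mapping.lookup x i + ?s x (K - {i})"
          using finK i by (simp add: sum.remove)
        moreover have "?s x K \<in> \<int>" using K g by auto
        ultimately have "Poly_Mapping.lookup x i \<in> \<int>" by (metis Ints_diff add_diff_cancel_right')
        with i show False by blast
      qed
      then obtain j where j: "j \<in> K" "j \<noteq> i" "Poly_Mapping.lookup x j \<notin> \<int>" by blast
      have sep: "K \<subseteq> I" if I: "?tight I" "l \<in> I" "l \<in> K" "Poly_Mapping.lookup x l \<notin> \<int>" for I l
      proof -
        have "?s x (I \<union> K) + ?s x (I \<inter> K) = ?s x I + ?s x K"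
          using E I(1) K(1) finite_subset by (intro sum.union_inter) blast+
        moreover have "g (I \<union> K) + g (I \<inter> K) \<le> g I + g K" using sub I K by blast
        moreover have "?s x (I \<union> K) \<le> g (I \<union> K)" "?s x (I \<inter> K) \<le> g (I \<inter> K)"
          using x(2) I K by blast+
        ultimately have "?tight (I \<inter> K)" using I K by auto
        then have "card K \<le> card (I \<inter> K)" using Kmin[of "I \<inter> K"] I by blast
        then have "I \<inter> K = K" using finK by (intro card_seteq) auto
        then show ?thesis by blast
      qed
      have ij: "i \<in> E" "j \<in> E" "i \<in> I \<longleftrightarrow> j \<in> I" if "I \<subseteq> E" "?s x I = g I" for I
        using sep[of I i] sep[of I j] that i j K by blast+
      have iE: "i \<in> E" "j \<in> E" using ij(1,2)[of E] x(3) by blast+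
      have fin: "finite {I. I \<subseteq> E \<and> ?s x I \<noteq> g I}" using E by simp
      obtain t y where y: "0 < t" "y = x + t *\<^sub>R (Poly_Mapping.single i 1 - Poly_Mapping.single j 1)"
        "y \<in> base_polytope E g"
        "{I. I \<subseteq> E \<and> ?s y I \<noteq> g I} \<subset> {I. I \<subseteq> E \<and> ?s x I \<noteq> g I}"
        by (rule base_polytope_move[OF E less.prems iE j(2)[symmetric] ij(3)])
      obtain u z where z: "0 < u" "z = x + u *\<^sub>R (Poly_Mapping.single j 1 - Poly_Mapping.single i 1)"
        "z \<in> base_polytope E g"
        "{I. I \<subseteq> E \<and> ?s z I \<noteq> g I} \<subset> {I. I \<subseteq> E \<and> ?s x I \<noteq> g I}"
        by (rule base_polytope_move[OF E less.prems iE(2,1) j(2) ij(3)[symmetric]])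
      have "y \<in> ?H" "z \<in> ?H"
        using less.hyps y(3,4) z(3,4) fin by (auto intro!: less.hyps psubset_card_mono)
      moreover have sum1: "u / (t + u) + t / (t + u) = 1"
        using y(1) z(1) by (simp add: add.commute flip: add_divide_distrib)
      ultimately have "(u / (t + u)) *\<^sub>R y + (t / (t + u)) *\<^sub>R z \<in> ?H"
        using y(1) z(1) by (intro convexD[OF convex_convex_hull]) auto
      moreover have "(u / (t + u)) *\<^sub>R y + (t / (t + u)) *\<^sub>R z = x"
      proof -
        have "(u / (t + u)) *\<^sub>R y + (t / (t + u)) *\<^sub>R z = (u / (t + u) + t / (t + u)) *\<^sub>R x"
          unfolding y(2) z(2) by (simp add: algebra_simps)
        then show ?thesis by (simp add: sum1)
      qed
      ultimately show ?thesis by simp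
    qed
  qed
qed

lemma convex_base_polytope: "convex (base_polytope E g)"
proof (rule convexI)
  fix x y and u v :: real
  assume x: "x \<in> base_polytope E g" and y: "y \<in> base_polytope E g" and uv: "0 \<le> u" "0 \<le> v" "u + v = 1"
  let ?z = "u *\<^sub>R x + v *\<^sub>R y"
  have s: "sum (Poly_Mapping.lookup ?z) I = u * sum (Poly_Mapping.lookup x) I + v * sum (Poly_Mapping.lookup y) I" for I
    by (simp add: lookup_add sum.distrib sum_distrib_left)
  have "sum (Poly_Mapping.lookup ?z) I \<le> g I" if "I \<subseteq> E" for I
    unfolding s using convex_bound_le[OF _ _ uv] x y that by (auto simp: base_polytope_def)
  moreover have "sum (Poly_Mapping.lookup ?z) E = g E"
    unfolding s using x y uv by (simp add: base_polytope_def flip: distrib_right)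
  moreover have "Poly_Mapping.keys ?z \<subseteq> E"
    using keys_scaleR_add[of u x v y] x y unfolding base_polytope_def by blast
  ultimately show "?z \<in> base_polytope E g" by (simp add: base_polytope_def)
qed

lemma generalized_permutahedron_base_polytope:
  assumes "g {} = 0"
    and sub: "\<And>I J. I \<subseteq> {1..n} \<Longrightarrow> J \<subseteq> {1..n} \<Longrightarrow> g (I \<union> J) + g (I \<inter> J) \<le> g I + g J"
  shows "generalized_permutahedron n (base_polytope {1..n} g)"
proof -
  let ?E = "{1..n}"
  define z where "z I = g ?E - g (?E - I)" for I
  have "z (I \<union> J) + z (I \<inter> J) \<ge> z I + z J" if "I \<subseteq> ?E" "J \<subseteq> ?E" for I J
  proof -
    have "?E - (I \<union> J) = (?E - I) \<inter> (?E - J)" "?E - (I \<inter> J) = (?E - I) \<union> (?E - J)" by auto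
    then show ?thesis using sub[of "?E - I" "?E - J"] by (auto simp: z_def)
  qed
  moreover have "base_polytope ?E g = perm_polytope n z"
  proof -
    have "(\<forall>I\<subseteq>?E. sum (Poly_Mapping.lookup t) I \<le> g I) \<longleftrightarrow>
      (\<forall>I. I \<subset> ?E \<longrightarrow> z I \<le> sum (Poly_Mapping.lookup t) I)"
      if "sum (Poly_Mapping.lookup t) ?E = g ?E" for t :: "nat \<Rightarrow>\<^sub>0 real"
    proof -
      have d: "sum (Poly_Mapping.lookup t) (?E - I) = g ?E - sum (Poly_Mapping.lookup t) I"
        if "I \<subseteq> ?E" for I
        using that \<open>sum (Poly_Mapping.lookup t) ?E = g ?E\<close> by (simp add: sum_diff)
      show ?thesis
      proof (intro iffI allI impI)
        fix I assume *: "\<forall>I\<subseteq>?E. sum (Poly_Mapping.lookup t) I \<le> g I" "I \<subset> ?E"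
        then have "sum (Poly_Mapping.lookup t) (?E - I) \<le> g (?E - I)" by blast
        then show "z I \<le> sum (Poly_Mapping.lookup t) I"
          using d[OF psubset_imp_subset[OF *(2)]] by (simp add: z_def)
      next
        fix I assume *: "\<forall>I. I \<subset> ?E \<longrightarrow> z I \<le> sum (Poly_Mapping.lookup t) I" "I \<subseteq> ?E"
        show "sum (Poly_Mapping.lookup t) I \<le> g I"
        proof (cases "I = {}")
          case False
          then have "?E - I \<subset> ?E" using *(2) by auto
          moreover have "?E - (?E - I) = I" using *(2) by auto
          ultimately show ?thesis
            using *(1)[rule_format, of "?E - I"] d[OF *(2)] by (auto simp: z_def)
        qed (simp add: assms(1))
      qed
    qed
    moreover have "z ?E = g ?E" by (simp add: z_def assms(1))
    ultimately show ?thesis unfolding base_polytope_def perm_polytope_def by auto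
  qed
  ultimately show ?thesis
    unfolding generalized_permutahedron_def by (intro exI[of _ z]) (auto simp: z_def)
qed

section \<open>Newton polytopes\<close>

lemma lookup_exponent_point [simp]:
  "Poly_Mapping.lookup (exponent_point \<alpha>) i = real (Poly_Mapping.lookup \<alpha> i)"
  by (simp add: exponent_point_def Poly_Mapping.map.rep_eq when_def)

lemma keys_exponent_point [simp]: "Poly_Mapping.keys (exponent_point \<alpha>) = Poly_Mapping.keys \<alpha>"
  by (auto simp: in_keys_iff)

text \<open>
  The coordinate \<open>0\<close> of a base is determined by the others, since the coordinates sum to \<open>f {0..n}\<close>.
\<close>

definition degree_set :: "nat \<Rightarrow> (nat set \<Rightarrow> nat) \<Rightarrow> exponent set" where
  "degree_set n f = {\<alpha>. Poly_Mapping.keys \<alpha> \<subseteq> {1..n} \<and>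
     (\<exists>x\<in>bases {0..n} f. \<forall>i\<in>{1..n}. x i = Poly_Mapping.lookup \<alpha> i)}"

definition degree_polytope :: "nat \<Rightarrow> (nat set \<Rightarrow> nat) \<Rightarrow> (nat \<Rightarrow>\<^sub>0 real) set" where
  "degree_polytope n f = {t. Poly_Mapping.keys t \<subseteq> {1..n} \<and>
     (\<forall>I\<subseteq>{1..n}. sum (Poly_Mapping.lookup t) I \<le> f I \<and>
       sum (Poly_Mapping.lookup t) I + (f {0..n} - sum (Poly_Mapping.lookup t) {1..n}) \<le> f (insert 0 I))}"

lemma insert_0_atLeast1: "{0..n} = insert 0 {1..n::nat}"
  by auto

lemma degree_polytope_exponent_point:
  assumes "polymatroid {0..n} f"
  shows "exponent_point \<alpha> \<in> degree_polytope n f \<longleftrightarrow> \<alpha> \<in> degree_set n f"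
proof
  assume "\<alpha> \<in> degree_set n f"
  then obtain x where \<alpha>: "Poly_Mapping.keys \<alpha> \<subseteq> {1..n}" and x: "x \<in> bases {0..n} f"
    and eq: "\<And>i. i \<in> {1..n} \<Longrightarrow> x i = Poly_Mapping.lookup \<alpha> i" by (auto simp: degree_set_def)
  have s: "sum (Poly_Mapping.lookup (exponent_point \<alpha>)) I = real (sum x I)" if "I \<subseteq> {1..n}" for I
    unfolding of_nat_sum by (intro sum.cong) (auto dest!: subsetD[OF that] simp: eq)
  have xs: "\<And>I. I \<subseteq> {0..n} \<Longrightarrow> sum x I \<le> f I" "sum x {0..n} = f {0..n}"
    using x by (auto simp: bases_def)
  have x0: "x 0 + sum x {1..n} = f {0..n}"
    using xs(2) by (simp add: insert_0_atLeast1)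
  have "real (sum x I) \<le> f I \<and> sum x I + (f {0..n} - real (sum x {1..n})) \<le> f (insert 0 I)"
    if I: "I \<subseteq> {1..n}" for I
  proof -
    have "finite I" "0 \<notin> I" using I finite_subset by auto
    then have "x 0 + sum x I \<le> f (insert 0 I)" "sum x I \<le> f I"
      using xs(1)[of "insert 0 I"] xs(1)[of I] I by force+
    then show ?thesis using x0 by linarith
  qed
  then show "exponent_point \<alpha> \<in> degree_polytope n f"
    using \<alpha> s by (auto simp: degree_polytope_def simp del: of_nat_sum lookup_exponent_point)
next
  assume *: "exponent_point \<alpha> \<in> degree_polytope n f"
  let ?a = "Poly_Mapping.lookup \<alpha>"
  have a: "real (sum ?a I) \<le> f I" "sum ?a I + (f {0..n} - real (sum ?a {1..n})) \<le> f (insert 0 I)"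
    if "I \<subseteq> {1..n}" for I using * that by (auto simp: degree_polytope_def)
  have "f {1..n} \<le> f {0..n}" by (rule polymatroidD(2)[OF assms]) auto
  then have le: "sum ?a {1..n} \<le> f {0..n}" using a(1)[OF order.refl] by linarith
  define x where "x = ?a(0 := f {0..n} - sum ?a {1..n})"
  have x: "sum x I = sum ?a I" if "0 \<notin> I" for I
    using that by (intro sum.cong) (auto simp: x_def)
  have "sum x I \<le> f I" if I: "I \<subseteq> {0..n}" for I
  proof (cases "0 \<in> I")
    case True
    define J where "J = I - {0}"
    have J: "I = insert 0 J" "0 \<notin> J" "J \<subseteq> {1..n}" "finite J"
      using True I finite_subset[OF I] by (auto simp: J_def Suc_le_eq intro: gr0I)
    have "sum x I = f {0..n} - sum ?a {1..n} + sum ?a J"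
      using J x[of J] by (simp add: x_def)
    then have "sum x I \<le> f (insert 0 J)" using a(2)[OF J(3)] le by linarith
    then show ?thesis by (simp only: J(1))
  next
    case False
    then have "I \<subseteq> {1..n}" using I by (force simp: Suc_le_eq intro: gr0I)
    then show ?thesis using a(1)[of I] x[OF False] by linarith
  qed
  moreover have "sum x {0..n} = f {0..n}"
  proof -
    have "sum x {0..n} = x 0 + sum x {1..n}" by (simp add: insert_0_atLeast1)
    moreover have "x 0 = f {0..n} - sum ?a {1..n}" by (simp add: x_def)
    ultimately show ?thesis using x[of "{1..n}"] le by simp
  qed
  moreover have keys: "Poly_Mapping.keys \<alpha> \<subseteq> {1..n}" using * by (simp add: degree_polytope_def)
  moreover have "x i = 0" if "i \<notin> {0..n}" for i
    using that keys by (auto simp: x_def in_keys_iff)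
  ultimately show "\<alpha> \<in> degree_set n f"
    unfolding degree_set_def bases_def by (auto simp: x_def intro!: exI[of _ x])
qed

lemma convex_degree_polytope: "convex (degree_polytope n f)"
proof (rule convexI)
  fix x y and u v :: real
  assume x: "x \<in> degree_polytope n f" and y: "y \<in> degree_polytope n f"
    and uv: "0 \<le> u" "0 \<le> v" "u + v = 1"
  let ?z = "u *\<^sub>R x + v *\<^sub>R y" and ?s = "\<lambda>x. sum (Poly_Mapping.lookup x)"
  have s: "?s ?z I = u * ?s x I + v * ?s y I" for I
    by (simp add: lookup_add sum.distrib sum_distrib_left)
  have "?s ?z I \<le> f I \<and> ?s ?z I + (f {0..n} - ?s ?z {1..n}) \<le> f (insert 0 I)"
    if I: "I \<subseteq> {1..n}" for I
  proof
    show "?s ?z I \<le> f I"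
      unfolding s using convex_bound_le[OF _ _ uv] x y I by (auto simp: degree_polytope_def)
    have "?s ?z I + (f {0..n} - ?s ?z {1..n}) =
      u * (?s x I + (f {0..n} - ?s x {1..n})) + v * (?s y I + (f {0..n} - ?s y {1..n})) +
      (1 - (u + v)) * f {0..n}"
      unfolding s by (simp add: algebra_simps)
    also have "\<dots> \<le> f (insert 0 I)"
      using convex_bound_le[OF _ _ uv] x y I uv(3) by (auto simp: degree_polytope_def)
    finally show "?s ?z I + (f {0..n} - ?s ?z {1..n}) \<le> f (insert 0 I)" .
  qed
  moreover have "Poly_Mapping.keys ?z \<subseteq> {1..n}"
    using keys_scaleR_add[of u x v y] x y unfolding degree_polytope_def by blast
  ultimately show "?z \<in> degree_polytope n f" by (simp add: degree_polytope_def)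
qed

lemma degree_polytope_integral_points:
  assumes f: "polymatroid {0..n} f"
  shows "{t \<in> degree_polytope n f. \<forall>i. Poly_Mapping.lookup t i \<in> \<int>} =
    exponent_point ` degree_set n f"
proof (intro equalityI subsetI)
  fix t assume "t \<in> {t \<in> degree_polytope n f. \<forall>i. Poly_Mapping.lookup t i \<in> \<int>}"
  then have t: "t \<in> degree_polytope n f" and int: "\<And>i. Poly_Mapping.lookup t i \<in> \<int>" by auto
  have "0 \<le> Poly_Mapping.lookup t i" for i
  proof (cases "i \<in> {1..n}")
    case True
    let ?I = "{1..n} - {i}"
    have "sum (Poly_Mapping.lookup t) ?I + (f {0..n} - sum (Poly_Mapping.lookup t) {1..n}) \<le> f (insert 0 ?I)"
      using t by (auto simp: degree_polytope_def)
    moreover have "f (insert 0 ?I) \<le> f {0..n}" by (rule polymatroidD(2)[OF f]) auto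
    moreover have "sum (Poly_Mapping.lookup t) {1..n} = Poly_Mapping.lookup t i + sum (Poly_Mapping.lookup t) ?I"
      using True by (simp add: sum.remove)
    ultimately show ?thesis by linarith
  next
    case False
    then have "i \<notin> Poly_Mapping.keys t" using t by (auto simp: degree_polytope_def)
    then show ?thesis by (simp add: in_keys_iff)
  qed
  then have "real (nat \<lfloor>Poly_Mapping.lookup t i\<rfloor>) = Poly_Mapping.lookup t i" for i
    using int[of i] by (metis Ints_cases floor_of_int of_int_0_le_iff of_nat_nat of_int_of_nat_eq)
  then have "exponent_point (Poly_Mapping.map (\<lambda>r. nat \<lfloor>r\<rfloor>) t) = t"
    by (intro poly_mapping_eqI) (auto simp: Poly_Mapping.map.rep_eq when_def)
  then show "t \<in> exponent_point ` degree_set n f"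
    using t degree_polytope_exponent_point[OF f] by (metis imageI)
next
  fix t assume "t \<in> exponent_point ` degree_set n f"
  then show "t \<in> {t \<in> degree_polytope n f. \<forall>i. Poly_Mapping.lookup t i \<in> \<int>}"
    using degree_polytope_exponent_point[OF f] by auto
qed

lemma total_degree_eq:
  assumes "finite A" "Poly_Mapping.keys \<alpha> \<subseteq> A"
  shows "total_degree \<alpha> = sum (Poly_Mapping.lookup \<alpha>) A"
  unfolding total_degree_def using assms by (intro sum.mono_neutral_left) (auto simp: in_keys_iff)

lemma SNP_degree_set:
  assumes "polymatroid {0..n} f" "Poly_Mapping.keys p = degree_set n f"
  shows "SNP p"
proof -
  have "exponent_point ` degree_set n f \<subseteq> degree_polytope n f"
    using degree_polytope_exponent_point[OF assms(1)] by auto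
  then have "Newton p \<subseteq> degree_polytope n f"
    unfolding Newton_def assms(2) by (intro hull_minimal convex_degree_polytope)
  moreover have "exponent_point ` degree_set n f \<subseteq> Newton p"
    unfolding Newton_def assms(2) by (rule hull_subset)
  ultimately show ?thesis
    unfolding SNP_def assms(2) using degree_polytope_integral_points[OF assms(1)] by auto
qed

lemma generalized_permutahedron_degree_slice:
  assumes f: "polymatroid {0..n} f" and k: "k \<le> f {0..n}"
    and keys: "Poly_Mapping.keys p = {\<alpha> \<in> degree_set n f. total_degree \<alpha> = f {0..n} - k}"
    and "p \<noteq> 0"
  shows "generalized_permutahedron n (Newton p)"
proof -
  let ?E = "{1..n}" and ?d = "f {0..n} - k" and ?s = "\<lambda>x. sum (Poly_Mapping.lookup x)"
  define g where "g I = min (real (f I)) (real (f (insert 0 I)) - k)" for I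
  have E: "insert 0 I \<subseteq> {0..n}" if "I \<subseteq> ?E" for I using that by auto
  note sub = polymatroidD(3)[OF f] and mono = polymatroidD(2)[OF f]
  have gsub: "g (I \<union> J) + g (I \<inter> J) \<le> g I + g J" if IJ: "I \<subseteq> ?E" "J \<subseteq> ?E" for I J
  proof -
    have IJ0: "I \<subseteq> {0..n}" "J \<subseteq> {0..n}" "0 \<notin> I" "0 \<notin> J" using IJ by auto
    have ins: "insert 0 I \<union> J = insert 0 (I \<union> J)" "I \<union> insert 0 J = insert 0 (I \<union> J)"
      "insert 0 I \<inter> J = I \<inter> J" "I \<inter> insert 0 J = I \<inter> J"
      "insert 0 I \<union> insert 0 J = insert 0 (I \<union> J)" "insert 0 I \<inter> insert 0 J = insert 0 (I \<inter> J)"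
      using IJ0 by auto
    show ?thesis
      using sub[OF IJ0(1,2)] sub[OF E[OF IJ(1)] IJ0(2)] sub[OF IJ0(1) E[OF IJ(2)]]
        sub[OF E[OF IJ(1)] E[OF IJ(2)]] unfolding ins g_def by linarith
  qed
  obtain \<beta> where \<beta>: "\<beta> \<in> degree_set n f" "total_degree \<beta> = ?d"
    using assms(4) keys keys_eq_empty[of p] by blast
  then have \<beta>s: "?s (exponent_point \<beta>) ?E = ?d" and \<beta>P: "exponent_point \<beta> \<in> degree_polytope n f"
    using total_degree_eq[of ?E \<beta>] degree_polytope_exponent_point[OF f]
    by (auto simp: degree_set_def simp flip: of_nat_sum)
  have \<beta>I: "?s (exponent_point \<beta>) I \<le> f I"
    "?s (exponent_point \<beta>) I + (f {0..n} - ?s (exponent_point \<beta>) ?E) \<le> f (insert 0 I)"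
    if "I \<subseteq> ?E" for I using \<beta>P that unfolding degree_polytope_def by blast+
  have "?d \<le> real (f ?E)" "f {0..n} - real ?d \<le> f {0}"
    using \<beta>I(1)[OF order.refl, unfolded \<beta>s] \<beta>I(2)[OF empty_subsetI, unfolded \<beta>s] by simp_all
  then have g0: "g {} = 0" and gE: "g ?E = ?d"
    using k polymatroidD(1)[OF f] unfolding g_def insert_0_atLeast1[symmetric] by auto
  have slice: "base_polytope ?E g = {t \<in> degree_polytope n f. ?s t ?E = ?d}"
  proof -
    have d: "real (f {0..n}) - real ?d = k" using k by simp
    have "(\<forall>I\<subseteq>?E. ?s t I \<le> g I) \<longleftrightarrow>
      (\<forall>I\<subseteq>?E. ?s t I \<le> f I \<and> ?s t I + (f {0..n} - ?s t ?E) \<le> f (insert 0 I))"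
      if "?s t ?E = ?d" for t :: "nat \<Rightarrow>\<^sub>0 real"
      unfolding that d by (simp only: g_def min.bounded_iff le_diff_eq)
    then show ?thesis unfolding base_polytope_def degree_polytope_def gE by blast
  qed
  have "{t \<in> base_polytope ?E g. \<forall>i. Poly_Mapping.lookup t i \<in> \<int>} = exponent_point ` Poly_Mapping.keys p"
  proof -
    have "?s (exponent_point \<alpha>) ?E = ?d \<longleftrightarrow> total_degree \<alpha> = ?d" if "\<alpha> \<in> degree_set n f" for \<alpha>
      using total_degree_eq[of ?E \<alpha>] that by (auto simp: degree_set_def simp flip: of_nat_sum)
    moreover have "{t \<in> base_polytope ?E g. \<forall>i. Poly_Mapping.lookup t i \<in> \<int>} =
      {t \<in> exponent_point ` degree_set n f. ?s t ?E = ?d}"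
      using degree_polytope_integral_points[OF f] unfolding slice by auto
    ultimately show ?thesis unfolding keys by auto
  qed
  moreover have "base_polytope ?E g \<subseteq> convex hull {t \<in> base_polytope ?E g. \<forall>i. Poly_Mapping.lookup t i \<in> \<int>}"
    by (intro base_polytope_integral gsub) (auto simp: g_def min_def)
  moreover have "convex hull {t \<in> base_polytope ?E g. \<forall>i. Poly_Mapping.lookup t i \<in> \<int>} \<subseteq> base_polytope ?E g"
    by (intro hull_minimal convex_base_polytope) auto
  ultimately have "Newton p = base_polytope ?E g" by (simp add: Newton_def)
  then show ?thesis
    using generalized_permutahedron_base_polytope[OF g0 gsub] by simp
qed

lemma keys_homogeneous_component:
  "Poly_Mapping.keys (homogeneous_component d p) = {\<alpha> \<in> Poly_Mapping.keys p. total_degree \<alpha> = d}"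
proof -
  have "finite {\<alpha>. \<alpha> \<in> Poly_Mapping.keys p \<and> total_degree \<alpha> = d}" by simp
  then have "Poly_Mapping.lookup (homogeneous_component d p) \<alpha> =
    (if \<alpha> \<in> Poly_Mapping.keys p \<and> total_degree \<alpha> = d then Poly_Mapping.lookup p \<alpha> else 0)" for \<alpha>
    by (simp add: homogeneous_component_def lookup_sum lookup_single when_def)
  then show ?thesis by (auto simp: in_keys_iff split: if_splits)
qed

lemma keys_left_degree_polynomial:
  "Poly_Mapping.keys (left_degree_polynomial n G T) = set_mset (InSeq n T)"
proof -
  have "Poly_Mapping.lookup (\<Sum>\<beta>\<in>#M. Poly_Mapping.single \<beta> (c \<beta>)) \<alpha> = int (count M \<alpha>) * c \<alpha>"
    for M and c :: "exponent \<Rightarrow> int" and \<alpha>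
    by (induction M) (auto simp: lookup_add lookup_single when_def algebra_simps)
  then show ?thesis
    by (auto simp: left_degree_polynomial_def in_keys_iff not_in_iff)
qed

lemma lookup_left_degree_seq:
  "Poly_Mapping.lookup (left_degree_seq n L) i = (if i \<in> {1..n} then indeg L i else 0)"
  by (simp add: left_degree_seq_def lookup_sum lookup_single when_def)

lemma sum_indeg: "graph_on n L \<Longrightarrow> sum (indeg L) {1..n} = size L"
proof (induction L)
  case (add e L)
  then have "snd e \<in> {1..n}" "graph_on n L" by (auto simp: graph_on_def)
  then show ?case using add.IH by (simp add: sum.distrib)
qed simp

lemma leaves_nonempty: "leaves T \<noteq> {#}"
  by (induction T) auto

lemma InSeq_degree_set:
  assumes G: "graph_on n G" and T: "specific_tree G n T"
  obtains f where "polymatroid {0..n} f" "f {0..n} = size G" "set_mset (InSeq n T) = degree_set n f"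
proof -
  have rest: "filter_mset (\<lambda>e. n < snd e) G = {#}"
    using G by (auto simp: graph_on_def filter_mset_eq_conv)
  obtain f where f: "polymatroid {0..n} f"
    "degree_vector (size G) ` set_mset (leaves T) = bases {0..n} f"
    using specific_tree_polymatroidal[OF G T order.refl] unfolding polymatroidal_def rest by auto
  have leaf: "graph_on n L" "size L \<le> size G" if "L \<in># leaves T" for L
    using reduction_tree_leaves[OF specific_tree_is_reduction_tree[OF G T] G that] by auto
  obtain L where L: "L \<in># leaves T" using leaves_nonempty by blast
  have "sum (degree_vector (size G) L) {1..n} = sum (indeg L) {1..n}"
    by (intro sum.cong) (auto simp: degree_vector_def)
  then have "sum (degree_vector (size G) L) {0..n} = size G"
    using leaf(2)[OF L] sum_indeg[OF leaf(1)[OF L]]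
    by (simp add: insert_0_atLeast1) (simp add: degree_vector_def)
  moreover have "degree_vector (size G) L \<in> bases {0..n} f" using f(2) L by blast
  ultimately have "f {0..n} = size G" by (simp add: bases_def)
  moreover have "set_mset (InSeq n T) = degree_set n f"
  proof (intro equalityI subsetI)
    fix \<alpha> assume "\<alpha> \<in># InSeq n T"
    then obtain L where L: "L \<in># leaves T" "\<alpha> = left_degree_seq n L" by (auto simp: InSeq_def)
    then have "degree_vector (size G) L \<in> bases {0..n} f" using f(2) by blast
    then show "\<alpha> \<in> degree_set n f"
      unfolding degree_set_def L(2)
      by (auto simp: lookup_left_degree_seq degree_vector_def in_keys_iff split: if_splits
          intro!: bexI[of _ "degree_vector (size G) L"])
  next
    fix \<alpha> assume "\<alpha> \<in> degree_set n f"
    then obtain x where \<alpha>: "Poly_Mapping.keys \<alpha> \<subseteq> {1..n}" "x \<in> bases {0..n} f"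
      "\<And>i. i \<in> {1..n} \<Longrightarrow> x i = Poly_Mapping.lookup \<alpha> i" by (auto simp: degree_set_def)
    then obtain L where L: "L \<in># leaves T" "x = degree_vector (size G) L" using f(2) by blast
    have "Poly_Mapping.lookup \<alpha> i = Poly_Mapping.lookup (left_degree_seq n L) i" for i
      using \<alpha>(1) \<alpha>(3)[of i] L(2) by (auto simp: lookup_left_degree_seq degree_vector_def in_keys_iff)
    then have "\<alpha> = left_degree_seq n L" by (intro poly_mapping_eqI)
    then show "\<alpha> \<in># InSeq n T" using L(1) by (auto simp: InSeq_def)
  qed
  ultimately show ?thesis using f(1) that by blast
qed

theorem theoremB:
  fixes n :: nat and G :: graph and T :: gtree
  assumes "graph_on n G"
    and "specific_tree G n T"
  shows "SNP (left_degree_polynomial n G T) \<and>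
    (\<forall>k \<le> size G.
       homogeneous_component (size G - k) (left_degree_polynomial n G T) \<noteq> 0 \<longrightarrow>
       generalized_permutahedron n
         (Newton (homogeneous_component (size G - k) (left_degree_polynomial n G T))))"
proof -
  obtain f where f: "polymatroid {0..n} f" "f {0..n} = size G"
    and "set_mset (InSeq n T) = degree_set n f"
    using assms by (rule InSeq_degree_set)
  then have keys: "Poly_Mapping.keys (left_degree_polynomial n G T) = degree_set n f"
    by (simp add: keys_left_degree_polynomial)
  show ?thesis
    using SNP_degree_set[OF f(1) keys] generalized_permutahedron_degree_slice[OF f(1)]
    by (simp add: f(2) keys_homogeneous_component keys)
qed

end
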